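(* Let $\varphi:\mathbb B\to\mathbb B$ be slice regular with $\|\varphi\|_\infty=\sup_{q\in\mathbb B}|\varphi(q)|<1$. Then for every $1\le p\le\infty$, the operators $C_\varphi f=f^{\odot}\varphi$ and $D_\varphi f=f_{\odot}\varphi$ are compact operators on $H^p(\mathbb B)$.
   Context: $\mathbb H$ quaternions, $\mathbb S=\{q:q^2=-1\}$, $\mathbb B$ open unit ball. Slice regular functions on $\mathbb B$ (functions whose restriction to each $\mathbb B\cap(\mathbb R+I\mathbb R)$, $I\in\mathbb S$, is $C^1$ and annihilated by $\frac12(\partial_x+I\partial_y)$) are exactly convergent power series $\sum_nq^na_n$. $\ast$-product: $\big(\sum q^na_n\big)\ast\big(\sum q^nb_n\big)=\sum_nq^n\sum_{k}a_kb_{n-k}$; $\varphi^{\ast0}=1$, $\varphi^{\ast n}=\varphi\ast\varphi^{\ast(n-1)}$. For $f=\sum q^na_n$: $f^{\odot}\varphi=\sum_n\varphi^{\ast n}a_n$, $f_{\odot}\varphi=\sum_na_n\ast\varphi^{\ast n}$. Hardy spaces: for $0<p<\infty$, $\|f\|_p=\sup_{I\in\mathbb S}\lim_{r\to1^-}(\frac1{2\pi}\int_{-\pi}^\pi|f(re^{I\theta})|^pd\theta)^{1/p}$, $\|f\|_\infty=\sup_{\mathbb B}|f|$, $H^p(\mathbb B)=\{f$ regular on $\mathbb B:\|f\|_p<\infty\}$ (a real Banach space; compactness is in the usual sense of mapping bounded sets to relatively compact sets). *)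

theory Defs
  imports "HOL-Analysis.Analysis"
begin

section \<open>Quaternions (built by hand; the AFP entry is not available)\<close>

datatype quat = Quat (Re: real) (Im1: real) (Im2: real) (Im3: real)

lemma quat_eqI: "Re x = Re y \<Longrightarrow> Im1 x = Im1 y \<Longrightarrow> Im2 x = Im2 y \<Longrightarrow> Im3 x = Im3 y \<Longrightarrow> x = y"
  by (cases x; cases y) auto

lemma quat_eq_iff: "x = y \<longleftrightarrow> Re x = Re y \<and> Im1 x = Im1 y \<and> Im2 x = Im2 y \<and> Im3 x = Im3 y"
  by (auto intro: quat_eqI)

instantiation quat :: ab_group_add
begin
definition "0 = Quat 0 0 0 0"
definition "x + y = Quat (Re x + Re y) (Im1 x + Im1 y) (Im2 x + Im2 y) (Im3 x + Im3 y)"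
definition "- x = Quat (- Re x) (- Im1 x) (- Im2 x) (- Im3 x)"
definition "x - y = Quat (Re x - Re y) (Im1 x - Im1 y) (Im2 x - Im2 y) (Im3 x - Im3 y)"
instance by standard (simp_all add: zero_quat_def plus_quat_def uminus_quat_def minus_quat_def quat_eq_iff)
end

lemma quat_add_simps [simp]:
  "Re 0 = 0" "Im1 0 = 0" "Im2 0 = 0" "Im3 0 = 0"
  "Re (x + y) = Re x + Re y" "Im1 (x + y) = Im1 x + Im1 y" "Im2 (x + y) = Im2 x + Im2 y" "Im3 (x + y) = Im3 x + Im3 y"
  "Re (- x) = - Re x" "Im1 (- x) = - Im1 x" "Im2 (- x) = - Im2 x" "Im3 (- x) = - Im3 x"
  "Re (x - y) = Re x - Re y" "Im1 (x - y) = Im1 x - Im1 y" "Im2 (x - y) = Im2 x - Im2 y" "Im3 (x - y) = Im3 x - Im3 y"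
  by (simp_all add: zero_quat_def plus_quat_def uminus_quat_def minus_quat_def)

instantiation quat :: real_vector
begin
definition "scaleR r x = Quat (r * Re x) (r * Im1 x) (r * Im2 x) (r * Im3 x)"
instance by standard (simp_all add: scaleR_quat_def quat_eq_iff algebra_simps)
end

lemma quat_scaleR_simps [simp]:
  "Re (scaleR r x) = r * Re x" "Im1 (scaleR r x) = r * Im1 x" "Im2 (scaleR r x) = r * Im2 x" "Im3 (scaleR r x) = r * Im3 x"
  by (simp_all add: scaleR_quat_def)

instantiation quat :: "{ring_1, inverse}"
begin
definition "1 = Quat 1 0 0 0"
definition "x * y = Quat
   (Re x * Re y - Im1 x * Im1 y - Im2 x * Im2 y - Im3 x * Im3 y)
   (Re x * Im1 y + Im1 x * Re y + Im2 x * Im3 y - Im3 x * Im2 y)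
   (Re x * Im2 y - Im1 x * Im3 y + Im2 x * Re y + Im3 x * Im1 y)
   (Re x * Im3 y + Im1 x * Im2 y - Im2 x * Im1 y + Im3 x * Re y)"
definition "inverse x = (let n = (Re x)\<^sup>2 + (Im1 x)\<^sup>2 + (Im2 x)\<^sup>2 + (Im3 x)\<^sup>2 in
   Quat (Re x / n) (- Im1 x / n) (- Im2 x / n) (- Im3 x / n))"
definition "(x::quat) div y = x * inverse y"
instance by standard (simp_all add: one_quat_def times_quat_def quat_eq_iff algebra_simps)
end

lemma quat_mult_simps [simp]:
  "Re 1 = 1" "Im1 1 = 0" "Im2 1 = 0" "Im3 1 = 0"
  "Re (x * y) = Re x * Re y - Im1 x * Im1 y - Im2 x * Im2 y - Im3 x * Im3 y"
  "Im1 (x * y) = Re x * Im1 y + Im1 x * Re y + Im2 x * Im3 y - Im3 x * Im2 y"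
  "Im2 (x * y) = Re x * Im2 y - Im1 x * Im3 y + Im2 x * Re y + Im3 x * Im1 y"
  "Im3 (x * y) = Re x * Im3 y + Im1 x * Im2 y - Im2 x * Im1 y + Im3 x * Re y"
  by (simp_all add: one_quat_def times_quat_def)

lemma quat_nsq_pos: "x \<noteq> 0 \<Longrightarrow> (Re x)\<^sup>2 + (Im1 x)\<^sup>2 + (Im2 x)\<^sup>2 + (Im3 x)\<^sup>2 > 0"
proof -
  assume x: "x \<noteq> 0"
  have "(Re x)\<^sup>2 + (Im1 x)\<^sup>2 + (Im2 x)\<^sup>2 + (Im3 x)\<^sup>2 \<noteq> 0"
    using x by (auto simp: add_nonneg_eq_0_iff quat_eq_iff)
  moreover have "(Re x)\<^sup>2 + (Im1 x)\<^sup>2 + (Im2 x)\<^sup>2 + (Im3 x)\<^sup>2 \<ge> 0" by simp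
  ultimately show ?thesis by linarith
qed

instance quat :: division_ring
proof
  fix x :: quat assume "x \<noteq> 0"
  hence n: "(Re x)\<^sup>2 + (Im1 x)\<^sup>2 + (Im2 x)\<^sup>2 + (Im3 x)\<^sup>2 \<noteq> 0" using quat_nsq_pos by (metis less_irrefl)
  show "inverse x * x = 1" "x * inverse x = 1"
  proof -
    define N where "N = (Re x)\<^sup>2 + (Im1 x)\<^sup>2 + (Im2 x)\<^sup>2 + (Im3 x)\<^sup>2"
    have N: "N \<noteq> 0" using n by (simp add: N_def)
    have i: "inverse x = Quat (Re x / N) (- Im1 x / N) (- Im2 x / N) (- Im3 x / N)"
      by (simp add: inverse_quat_def Let_def N_def)
    show "inverse x * x = 1" using N
      by (simp add: i quat_eq_iff divide_simps) (simp add: N_def power2_eq_square algebra_simps)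
    show "x * inverse x = 1" using N
      by (simp add: i quat_eq_iff divide_simps) (simp add: N_def power2_eq_square algebra_simps)
  qed
next
  show "inverse (0::quat) = 0" by (simp add: inverse_quat_def quat_eq_iff)
qed (simp add: divide_quat_def)

instance quat :: real_algebra_1
  by standard (simp_all add: quat_eq_iff algebra_simps)

instantiation quat :: real_normed_div_algebra
begin
definition "norm x = sqrt ((Re x)\<^sup>2 + (Im1 x)\<^sup>2 + (Im2 x)\<^sup>2 + (Im3 x)\<^sup>2)"
definition "sgn (x::quat) = x /\<^sub>R norm x"
definition "dist (x::quat) y = norm (x - y)"
definition "uniformity = (INF e\<in>{0<..}. principal {(x::quat, y). dist x y < e})"
definition "open (U :: quat set) \<longleftrightarrow> (\<forall>x\<in>U. \<forall>\<^sub>F (x', y) in uniformity. x' = x \<longrightarrow> y \<in> U)"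
instance
proof
  fix x y :: quat and r :: real
  show "norm (x * y) = norm x * norm y"
    by (simp add: norm_quat_def real_sqrt_mult[symmetric] power2_eq_square algebra_simps)
  show "norm (x + y) \<le> norm x + norm y"
  proof -
    have "norm (x+y) = L2_set (\<lambda>i. [Re x, Im1 x, Im2 x, Im3 x] ! i + [Re y, Im1 y, Im2 y, Im3 y] ! i) {..<4}"
      by (simp add: norm_quat_def L2_set_def numeral_eq_Suc lessThan_Suc add_ac)
    also have "\<dots> \<le> L2_set (\<lambda>i. [Re x, Im1 x, Im2 x, Im3 x] ! i) {..<4} + L2_set (\<lambda>i. [Re y, Im1 y, Im2 y, Im3 y] ! i) {..<4}"
      by (rule L2_set_triangle_ineq)
    also have "\<dots> = norm x + norm y"
      by (simp add: norm_quat_def L2_set_def numeral_eq_Suc lessThan_Suc add_ac)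
    finally show ?thesis .
  qed
  show "norm (scaleR r x) = \<bar>r\<bar> * norm x"
    by (simp add: norm_quat_def power_mult_distrib distrib_left[symmetric] real_sqrt_mult)
  show "(norm x = 0) = (x = 0)"
    by (simp add: norm_quat_def quat_eq_iff add_nonneg_eq_0_iff)
qed (rule sgn_quat_def dist_quat_def uniformity_quat_def open_quat_def)+
end


section \<open>Slice regularity, star product, composition operators, Hardy spaces\<close>

text \<open>The unit 2-sphere of imaginary units and the open unit ball.\<close>
definition qS :: "quat set" where "qS = {q. q * q = - 1}"
definition qB :: "quat set" where "qB = ball 0 1"

text \<open>Slice regularity on an open set Omega: for each I in qS, the restriction
  g(x,y) = f(x + I y) to Omega intersected with the slice L_I is C^1 (differentiable,
  with continuous partial derivatives) and satisfies (1/2)(d/dx + I d/dy) g = 0,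
  with I multiplied on the left.\<close>
definition slice_regular :: "(quat \<Rightarrow> quat) \<Rightarrow> quat set \<Rightarrow> bool" where
  "slice_regular f \<Omega> \<longleftrightarrow> (\<forall>I\<in>qS.
     (let g = (\<lambda>z::real \<times> real. f (of_real (fst z) + I * of_real (snd z)));
          U = {z::real \<times> real. of_real (fst z) + I * of_real (snd z) \<in> \<Omega>}
      in (\<forall>z\<in>U. g differentiable (at z))
         \<and> continuous_on U (\<lambda>z. frechet_derivative g (at z) (1, 0))
         \<and> continuous_on U (\<lambda>z. frechet_derivative g (at z) (0, 1))
         \<and> (\<forall>z\<in>U. (1/2) *\<^sub>R (frechet_derivative g (at z) (1, 0)
                                  + I * frechet_derivative g (at z) (0, 1)) = 0)))"

text \<open>Coefficients of the power series expansion f(q) = sum q^n a_n on the unit ball.\<close>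
definition coeffs :: "(quat \<Rightarrow> quat) \<Rightarrow> nat \<Rightarrow> quat" where
  "coeffs f = (THE a. \<forall>q\<in>qB. (\<lambda>n. q ^ n * a n) sums f q)"

text \<open>The star product of (the power series of) two regular functions on qB.\<close>
definition star_prod :: "(quat \<Rightarrow> quat) \<Rightarrow> (quat \<Rightarrow> quat) \<Rightarrow> quat \<Rightarrow> quat" where
  "star_prod f g = (\<lambda>q. \<Sum>n. q ^ n * (\<Sum>k\<le>n. coeffs f k * coeffs g (n - k)))"

primrec star_pow :: "(quat \<Rightarrow> quat) \<Rightarrow> nat \<Rightarrow> quat \<Rightarrow> quat" where
  "star_pow \<phi> 0 = (\<lambda>q. 1)"
| "star_pow \<phi> (Suc n) = star_prod \<phi> (star_pow \<phi> n)"

text \<open>C_phi f = f^odot phi = sum_n phi^{*n} a_n  and  D_phi f = f_odot phi = sum_n a_n * phi^{*n}.\<close>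
definition C_op :: "(quat \<Rightarrow> quat) \<Rightarrow> (quat \<Rightarrow> quat) \<Rightarrow> quat \<Rightarrow> quat" where
  "C_op \<phi> f = (\<lambda>q. \<Sum>n. star_pow \<phi> n q * coeffs f n)"

definition D_op :: "(quat \<Rightarrow> quat) \<Rightarrow> (quat \<Rightarrow> quat) \<Rightarrow> quat \<Rightarrow> quat" where
  "D_op \<phi> f = (\<lambda>q. \<Sum>n. star_prod (\<lambda>_. coeffs f n) (star_pow \<phi> n) q)"

text \<open>Hardy norm (valued in the extended reals), for 0 < p < \<infinity> and p = \<infinity>.
  r e^{I theta} = r (cos theta + I sin theta).\<close>
definition hardy_norm :: "ereal \<Rightarrow> (quat \<Rightarrow> quat) \<Rightarrow> ereal" where
  "hardy_norm p f =
     (if p = \<infinity> then (SUP q\<in>qB. ereal (norm (f q)))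
      else (SUP I\<in>qS. Lim (at_left (1::real))
              (\<lambda>r. ereal (((1 / (2 * pi)) * integral {-pi..pi}
                   (\<lambda>\<theta>. norm (f (of_real r * (of_real (cos \<theta>) + I * of_real (sin \<theta>))))
                          powr real_of_ereal p)) powr (1 / real_of_ereal p)))))"

definition hardy :: "ereal \<Rightarrow> (quat \<Rightarrow> quat) set" where
  "hardy p = {f. slice_regular f qB \<and> hardy_norm p f < \<infinity>}"

text \<open>T is a compact (real-linear) operator on H^p: it maps H^p into H^p, is real-linear
  (functions in H^p being identified by their values on qB), and maps bounded sets to
  relatively compact sets (every bounded sequence has a subsequence whose image converges
  in H^p).\<close>
definition compact_hardy_op :: "ereal \<Rightarrow> ((quat \<Rightarrow> quat) \<Rightarrow> (quat \<Rightarrow> quat)) \<Rightarrow> bool" where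
  "compact_hardy_op p T \<longleftrightarrow>
     (\<forall>f\<in>hardy p. T f \<in> hardy p)
   \<and> (\<forall>f\<in>hardy p. \<forall>g\<in>hardy p. \<forall>q\<in>qB. T (\<lambda>x. f x + g x) q = T f q + T g q)
   \<and> (\<forall>f\<in>hardy p. \<forall>c::real. \<forall>q\<in>qB. T (\<lambda>x. c *\<^sub>R f x) q = c *\<^sub>R T f q)
   \<and> (\<forall>F::nat \<Rightarrow> quat \<Rightarrow> quat. (\<forall>k. F k \<in> hardy p) \<longrightarrow> (\<exists>M. \<forall>k. hardy_norm p (F k) \<le> ereal M) \<longrightarrow>
        (\<exists>r g. strict_mono r \<and> g \<in> hardy p \<and>
              (\<lambda>k. hardy_norm p (\<lambda>q. T (F (r k)) q - g q)) \<longlonglongrightarrow> 0))"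

end

theory Submission
  imports Defs "HOL-Complex_Analysis.Complex_Analysis"
begin

text \<open>With \<open>c = sup |\<phi>| < 1\<close>, the star powers satisfy \<open>|\<phi>\<^sup>*\<^sup>n| \<le> c ^ n\<close> on the ball, because the star
  product at \<open>q\<close> is \<open>f q\<close> times a value of \<open>g\<close> at a point of the same norm as \<open>q\<close>. The coefficients of \<open>f\<close>
  are bounded by its Hardy norm, as the integral means over circles increase with the radius. Hence both
  operators factor through the coefficient sequences with geometrically decaying weights, and a diagonal
  subsequence that converges coefficientwise has uniformly convergent images; the supremum norm dominates
  every Hardy norm.\<close>

section \<open>Quaternions as a Euclidean space\<close>

instantiation quat :: euclidean_space
begin
definition "inner x y = quat.Re x * quat.Re y + Im1 x * Im1 y + Im2 x * Im2 y + Im3 x * Im3 y"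
definition "Basis = {1, Quat 0 1 0 0, Quat 0 0 1 0, Quat 0 0 0 1}"
instance
proof
  fix x y z :: quat and r :: real
  show "inner x y = inner y x" by (simp add: inner_quat_def mult.commute)
  show "inner (x + y) z = inner x z + inner y z" by (simp add: inner_quat_def algebra_simps)
  show "inner (r *\<^sub>R x) y = r * inner x y" by (simp add: inner_quat_def algebra_simps)
  show "0 \<le> inner x x" by (simp add: inner_quat_def)
  show "(inner x x = 0) = (x = 0)"
    by (simp add: inner_quat_def quat_eq_iff add_nonneg_eq_0_iff)
  show "norm x = sqrt (inner x x)"
    by (simp add: inner_quat_def norm_quat_def power2_eq_square)
  show "(Basis :: quat set) \<noteq> {}" by (simp add: Basis_quat_def)
  show "finite (Basis :: quat set)" by (simp add: Basis_quat_def)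
  show "(\<forall>u\<in>Basis. inner x u = 0) = (x = 0)"
    unfolding Basis_quat_def ball_simps by (simp add: inner_quat_def quat_eq_iff)
next
  fix u v :: quat
  show "u \<in> Basis \<Longrightarrow> v \<in> Basis \<Longrightarrow> inner u v = (if u = v then 1 else 0)"
    by (auto simp: Basis_quat_def inner_quat_def quat_eq_iff)
qed
end

lemma quat_of_real_simps [simp]:
  "quat.Re (of_real r) = r" "Im1 (of_real r) = 0" "Im2 (of_real r) = 0" "Im3 (of_real r) = 0"
  by (simp_all add: of_real_def)

lemma qS_iff: "I \<in> qS \<longleftrightarrow> quat.Re I = 0 \<and> (Im1 I)\<^sup>2 + (Im2 I)\<^sup>2 + (Im3 I)\<^sup>2 = 1"
proof
  assume "I \<in> qS"
  then have e: "quat.Re I * quat.Re I - Im1 I * Im1 I - Im2 I * Im2 I - Im3 I * Im3 I = -1"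
    "quat.Re I * Im1 I = 0" "quat.Re I * Im2 I = 0" "quat.Re I * Im3 I = 0"
    by (auto simp: qS_def quat_eq_iff)
  have "quat.Re I = 0"
  proof (rule ccontr)
    assume "quat.Re I \<noteq> 0"
    with e have "quat.Re I * quat.Re I = -1" by simp
    then show False using zero_le_square[of "quat.Re I"] by linarith
  qed
  with e show "quat.Re I = 0 \<and> (Im1 I)\<^sup>2 + (Im2 I)\<^sup>2 + (Im3 I)\<^sup>2 = 1"
    by (simp add: power2_eq_square)
next
  assume "quat.Re I = 0 \<and> (Im1 I)\<^sup>2 + (Im2 I)\<^sup>2 + (Im3 I)\<^sup>2 = 1"
  then show "I \<in> qS"
    by (auto simp: qS_def quat_eq_iff power2_eq_square)
qed

lemma qS_nonempty: "qS \<noteq> {}"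
proof -
  have "Quat 0 1 0 0 \<in> qS" by (simp add: qS_iff)
  then show ?thesis by blast
qed

section \<open>Slices as copies of the complex plane\<close>

definition emb :: "quat \<Rightarrow> complex \<Rightarrow> quat" where
  "emb I z = of_real (complex.Re z) + I * of_real (complex.Im z)"

text \<open>The orthogonal projection onto the slice of \<open>I\<close>, written in the coordinate of the slice; it is
  complex linear for left multiplication by the slice.\<close>

definition proj :: "quat \<Rightarrow> quat \<Rightarrow> complex" where
  "proj I q = Complex (quat.Re q) (inner I q)"

lemma emb_simps [simp]:
  "emb I 0 = 0" "emb I 1 = 1" "emb I (of_real x) = of_real x"
  "emb I (z + w) = emb I z + emb I w" "emb I (z - w) = emb I z - emb I w"
  "emb I \<i> = I"
  by (simp_all add: emb_def algebra_simps)

lemma emb_mult: "I \<in> qS \<Longrightarrow> emb I (z * w) = emb I z * emb I w"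
  unfolding qS_iff by (auto simp: emb_def quat_eq_iff algebra_simps power2_eq_square) algebra+

lemma emb_power: "I \<in> qS \<Longrightarrow> emb I (z ^ n) = emb I z ^ n"
  by (induction n) (simp_all add: emb_mult)

lemma norm_emb: "I \<in> qS \<Longrightarrow> norm (emb I z) = norm z"
proof -
  assume I: "I \<in> qS"
  have "(norm (emb I z))\<^sup>2 = (complex.Re z)\<^sup>2 +
      ((Im1 I)\<^sup>2 + (Im2 I)\<^sup>2 + (Im3 I)\<^sup>2) * (complex.Im z)\<^sup>2"
    using I[unfolded qS_iff, THEN conjunct1]
    by (simp add: emb_def norm_quat_def power_mult_distrib algebra_simps)
  also have "\<dots> = (norm z)\<^sup>2"
    using I by (simp add: qS_iff cmod_power2)
  finally show ?thesis by simp
qed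

lemma bounded_linear_emb: "I \<in> qS \<Longrightarrow> bounded_linear (emb I)"
proof (rule bounded_linear_intro[where K = 1])
  fix r z show "emb I (r *\<^sub>R z) = r *\<^sub>R emb I z"
    by (simp add: emb_def quat_eq_iff algebra_simps)
qed (simp_all add: norm_emb)

lemma bounded_linear_proj: "I \<in> qS \<Longrightarrow> bounded_linear (proj I)"
proof -
  assume I: "I \<in> qS"
  have lin: "linear (proj I)"
    by (rule linearI) (simp_all add: proj_def complex_eq_iff inner_add_right)
  then show ?thesis by (simp add: linear_conv_bounded_linear)
qed

lemma Re_proj [simp]: "complex.Re (proj I q) = quat.Re q"
  by (simp add: proj_def)

lemma proj_emb_mult: "I \<in> qS \<Longrightarrow> proj I (emb I z * q) = z * proj I q"
  unfolding qS_iff proj_def emb_def complex_eq_iff inner_quat_def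
  by (auto simp: algebra_simps power2_eq_square) algebra+

lemma slice_expansion:
  assumes "I \<in> qS"
  shows "2 *\<^sub>R q = (\<Sum>J\<in>Basis. emb I (proj I (q * J)) * inverse J)"
proof -
  have B: "(\<Sum>J\<in>Basis. f J) = f 1 + f (Quat 0 1 0 0) + f (Quat 0 0 1 0) + f (Quat 0 0 0 1)"
    for f :: "quat \<Rightarrow> quat"
    by (simp add: Basis_quat_def quat_eq_iff add.assoc)
  have inv: "inverse (Quat 0 1 0 0) = Quat 0 (-1) 0 0" "inverse (Quat 0 0 1 0) = Quat 0 0 (-1) 0"
    "inverse (Quat 0 0 0 1) = Quat 0 0 0 (-1)"
    by (simp_all add: inverse_quat_def)
  show ?thesis using assms
    unfolding B inv qS_iff quat_eq_iff emb_def proj_def inner_quat_def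
    by (auto simp: algebra_simps power2_eq_square) algebra+
qed

lemma quat_in_slice:
  obtains I z where "I \<in> qS" "q = emb I z" "norm z = norm q"
proof -
  define s where "s = sqrt ((Im1 q)\<^sup>2 + (Im2 q)\<^sup>2 + (Im3 q)\<^sup>2)"
  have s2: "s\<^sup>2 = (Im1 q)\<^sup>2 + (Im2 q)\<^sup>2 + (Im3 q)\<^sup>2" by (simp add: s_def)
  have ex: "\<exists>I z. I \<in> qS \<and> q = emb I z"
  proof (cases "s = 0")
    case True
    with s2 have "Im1 q = 0" "Im2 q = 0" "Im3 q = 0"
      by (auto simp: add_nonneg_eq_0_iff)
    then have "q = emb I (of_real (quat.Re q))" for I
      by (simp add: quat_eq_iff)
    then show ?thesis using qS_nonempty by blast
  next
    case False
    define I where "I = Quat 0 (Im1 q / s) (Im2 q / s) (Im3 q / s)"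
    have "I \<in> qS" unfolding qS_iff I_def using False
      by (simp add: power_divide add_divide_distrib[symmetric] flip: s2)
    moreover have "q = emb I (Complex (quat.Re q) s)"
      using False by (simp add: quat_eq_iff emb_def I_def)
    ultimately show ?thesis by blast
  qed
  then show ?thesis using that norm_emb by metis
qed

section \<open>Slice regular functions are power series\<close>

definition qseries :: "(quat \<Rightarrow> quat) \<Rightarrow> (nat \<Rightarrow> quat) \<Rightarrow> bool" where
  "qseries f a \<longleftrightarrow> (\<forall>q\<in>qB. (\<lambda>n. q ^ n * a n) sums f q)"

lemma qB_iff: "q \<in> qB \<longleftrightarrow> norm q < 1"
  by (simp add: qB_def)

lemma emb_in_qB: "I \<in> qS \<Longrightarrow> emb I z \<in> qB \<longleftrightarrow> norm z < 1"
  by (simp add: qB_iff norm_emb)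

lemma power_series_coeffs_zero:
  fixes a :: "nat \<Rightarrow> real"
  assumes "\<And>x. \<bar>x\<bar> < 1 \<Longrightarrow> (\<lambda>n. a n * x ^ n) sums 0"
  shows "a n = 0"
proof (cases "n = 0")
  case True
  then show ?thesis using assms[of 0] by simp
next
  case False
  show ?thesis
  proof (rule ccontr)
    assume "a n \<noteq> 0"
    show False
    proof (rule powser_0_nonzero[where r = 1 and \<xi> = 0 and a = a and f = "\<lambda>_. 0" and m = n])
      fix s :: real
      assume "0 < s" and s: "\<And>z::real. z \<in> cball 0 s - {0} \<Longrightarrow> (0::real) \<noteq> 0"
      from s[of s] \<open>0 < s\<close> show False by simp
    qed (use False \<open>a n \<noteq> 0\<close> assms in auto)
  qed
qed

lemma qseries_unique_real:
  assumes "\<And>x::real. \<bar>x\<bar> < 1 \<Longrightarrow> (\<lambda>n. of_real x ^ n * a n) sums f x"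
    and "\<And>x::real. \<bar>x\<bar> < 1 \<Longrightarrow> (\<lambda>n. of_real x ^ n * b n) sums f x"
  shows "a = (b :: nat \<Rightarrow> quat)"
proof
  fix n
  have "(\<lambda>n. inner (a n - b n) u * x ^ n) sums 0" if "\<bar>x\<bar> < 1" for x and u :: quat
  proof -
    have "(\<lambda>n. of_real x ^ n * a n - of_real x ^ n * b n) sums (f x - f x)"
      using assms that by (intro sums_diff)
    then have "(\<lambda>n. x ^ n *\<^sub>R (a n - b n)) sums 0"
      by (simp add: scaleR_conv_of_real right_diff_distrib)
    then have "(\<lambda>n. inner (x ^ n *\<^sub>R (a n - b n)) u) sums inner 0 u"
      by (rule bounded_linear.sums[OF bounded_linear_inner_left])
    then show ?thesis by (simp add: mult.commute)
  qed
  then have "inner (a n - b n) u = 0" for u :: quat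
    by (rule power_series_coeffs_zero)
  from this[of "a n - b n"] show "a n = b n" by simp
qed

lemma qseries_unique: "qseries f a \<Longrightarrow> qseries f b \<Longrightarrow> a = b"
  by (rule qseries_unique_real[of a "\<lambda>x. f (of_real x)"]) (auto simp: qseries_def qB_iff)

lemma coeffs_eqI: "qseries f a \<Longrightarrow> coeffs f = a"
  unfolding coeffs_def using qseries_unique
  by (intro the_equality) (auto simp: qseries_def)

lemma quat_of_real_commute: "of_real x * q = q * (of_real x :: quat)"
  by (simp add: quat_eq_iff mult.commute)

lemma qseries_abs_summable:
  assumes "qseries f a" "0 \<le> r" "r < 1"
  shows "summable (\<lambda>n. r ^ n * norm (a n))"
proof -
  obtain s where s: "r < s" "s < 1" using \<open>r < 1\<close> dense by blast
  have "(of_real s :: quat) \<in> qB" using s assms(2) by (simp add: qB_iff)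
  then have "summable (\<lambda>n. of_real s ^ n * a n)"
    using assms(1) sums_summable unfolding qseries_def by blast
  then have "summable (\<lambda>n. a n * of_real s ^ n)"
    by (simp add: quat_of_real_commute flip: of_real_power)
  from powser_insidea[OF this, of "of_real r"] show ?thesis
    using s assms(2) by (simp add: norm_mult norm_power mult.commute)
qed

lemma slice_regular_has_derivative:
  assumes "slice_regular f qB" "I \<in> qS" "norm z < 1"
  shows "\<exists>D. ((\<lambda>w. f (emb I w)) has_derivative (\<lambda>w. emb I w * D)) (at z)"
proof -
  define g where "g = (\<lambda>z::real \<times> real. f (of_real (fst z) + I * of_real (snd z)))"
  define c where "c = (\<lambda>z. (complex.Re z, complex.Im z))"
  have gc: "(\<lambda>w. f (emb I w)) = g \<circ> c" by (auto simp: g_def c_def emb_def)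
  have "of_real (fst (c z)) + I * of_real (snd (c z)) \<in> qB"
    using assms emb_in_qB[of I z] by (simp add: c_def emb_def)
  then have U: "c z \<in> {z. of_real (fst z) + I * of_real (snd z) \<in> qB}" by blast
  note R = bspec[OF assms(1)[unfolded slice_regular_def Let_def] assms(2)]
  have diff: "g differentiable (at (c z))"
    and cr: "(1/2) *\<^sub>R (frechet_derivative g (at (c z)) (1, 0)
        + I * frechet_derivative g (at (c z)) (0, 1)) = 0"
    unfolding g_def
    by (rule bspec[OF conjunct1[OF R] U],
        rule bspec[OF conjunct2[OF conjunct2[OF conjunct2[OF R]]] U])
  define G where "G = frechet_derivative g (at (c z))"
  have G: "(g has_derivative G) (at (c z))"
    using diff by (simp add: G_def frechet_derivative_works)
  have "I * (G (1, 0) + I * G (0, 1)) = 0"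
    using cr by (simp add: G_def)
  moreover have "I * I = -1" using assms(2) by (simp add: qS_def)
  ultimately have G01: "G (0, 1) = I * G (1, 0)"
    by (simp add: distrib_left flip: mult.assoc)
  have "(c has_derivative c) (at z)"
    unfolding c_def by (auto intro!: derivative_eq_intros)
  from diff_chain_at[OF this G] have "((\<lambda>w. f (emb I w)) has_derivative G \<circ> c) (at z)"
    by (simp add: gc)
  moreover have "(G \<circ> c) w = emb I w * G (1, 0)" for w
  proof -
    interpret G: bounded_linear G using G by (rule has_derivative_bounded_linear)
    have "c w = complex.Re w *\<^sub>R (1, 0) + complex.Im w *\<^sub>R (0, 1)" by (simp add: c_def)
    then have "G (c w) = complex.Re w *\<^sub>R G (1, 0) + complex.Im w *\<^sub>R G (0, 1)"
      by (simp only: G.add G.scaleR)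
    then show ?thesis
      by (simp add: emb_def G01 distrib_right Real_Vector_Spaces.of_real_def)
  qed
  ultimately show ?thesis by (auto simp: o_def)
qed

lemma slice_regularI:
  assumes der: "\<And>I z. I \<in> qS \<Longrightarrow> norm z < 1 \<Longrightarrow>
      ((\<lambda>w. f (emb I w)) has_derivative (\<lambda>w. emb I w * D I z)) (at z)"
    and cont: "\<And>I. I \<in> qS \<Longrightarrow> continuous_on (ball 0 1) (D I)"
  shows "slice_regular f qB"
  unfolding slice_regular_def
proof (rule ballI)
  fix I assume I: "I \<in> qS"
  define g where "g = (\<lambda>z::real \<times> real. f (of_real (fst z) + I * of_real (snd z)))"
  define U where "U = {z::real \<times> real. of_real (fst z) + I * of_real (snd z) \<in> qB}"
  define c where "c = (\<lambda>z::real \<times> real. Complex (fst z) (snd z))"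
  have c: "c = (\<lambda>z. of_real (fst z) + \<i> * of_real (snd z))"
    by (auto simp: c_def complex_eq_iff)
  have cU: "c z \<in> ball 0 1" if "z \<in> U" for z
    using that emb_in_qB[OF I, of "c z"] by (simp add: U_def c_def emb_def)
  have g: "g = (\<lambda>w. f (emb I w)) \<circ> c" by (auto simp: g_def c_def emb_def)
  have cder: "(c has_derivative c) (at z)" for z
    unfolding c by (auto intro!: derivative_eq_intros)
  have gder: "(g has_derivative (\<lambda>w. emb I (c w) * D I (c z))) (at z)" if "z \<in> U" for z
    using diff_chain_at[OF cder der[OF I]] cU[OF that] by (simp add: g o_def)
  then have fre: "frechet_derivative g (at z) = (\<lambda>w. emb I (c w) * D I (c z))" if "z \<in> U" for z
    using frechet_derivative_at[OF gder[OF that]] by simp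
  have "continuous_on U c" unfolding c by (intro continuous_intros)
  then have contD: "continuous_on U (\<lambda>z. D I (c z))"
    by (rule continuous_on_compose2[OF cont[OF I]]) (use cU in auto)
  have one: "emb I (c (1, 0)) = 1" "emb I (c (0, 1)) = I"
    by (simp_all add: c_def emb_def)
  have II: "I * I = -1" using I by (simp add: qS_def)
  have d: "\<forall>z\<in>U. g differentiable (at z)"
    using gder differentiableI by blast
  have c10: "continuous_on U (\<lambda>z. frechet_derivative g (at z) (1, 0))"
    by (rule continuous_on_eq[OF contD]) (simp add: fre one)
  have c01: "continuous_on U (\<lambda>z. frechet_derivative g (at z) (0, 1))"
    by (rule continuous_on_eq[OF continuous_on_mult_left[OF contD, of I]]) (simp add: fre one)
  have cr: "\<forall>z\<in>U. (1/2) *\<^sub>R (frechet_derivative g (at z) (1, 0)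
      + I * frechet_derivative g (at z) (0, 1)) = 0"
    by (simp add: fre one II flip: mult.assoc)
  show "let g = \<lambda>z::real \<times> real. f (of_real (fst z) + I * of_real (snd z));
          U = {z::real \<times> real. of_real (fst z) + I * of_real (snd z) \<in> qB}
      in (\<forall>z\<in>U. g differentiable (at z))
         \<and> continuous_on U (\<lambda>z. frechet_derivative g (at z) (1, 0))
         \<and> continuous_on U (\<lambda>z. frechet_derivative g (at z) (0, 1))
         \<and> (\<forall>z\<in>U. (1/2) *\<^sub>R (frechet_derivative g (at z) (1, 0)
                                  + I * frechet_derivative g (at z) (0, 1)) = 0)"
    using d c10 c01 cr unfolding Let_def g_def U_def by (intro conjI)
qed

lemma slice_regular_imp_qseries:
  assumes "slice_regular f qB"
  obtains a where "qseries f a"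
proof -
  have ex: "\<forall>I\<in>qS. \<exists>a. \<forall>z. norm z < 1 \<longrightarrow> (\<lambda>n. emb I z ^ n * a n) sums f (emb I z)"
  proof
    fix I assume I: "I \<in> qS"
    define h where "h J z = proj I (f (emb I z) * J)" for J z
    have "h J holomorphic_on ball 0 1" for J
    proof -
      have "\<exists>d. (h J has_field_derivative d) (at z)" if z: "norm z < 1" for z
      proof -
        obtain D where "((\<lambda>w. f (emb I w)) has_derivative (\<lambda>w. emb I w * D)) (at z)"
          using slice_regular_has_derivative[OF assms I z] by blast
        then have "((\<lambda>w. f (emb I w) * J) has_derivative (\<lambda>w. emb I w * D * J)) (at z)"
          by (rule bounded_linear.has_derivative[OF bounded_linear_mult_left])
        then have "((\<lambda>w. proj I (f (emb I w) * J)) has_derivative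
            (\<lambda>w. proj I (emb I w * D * J))) (at z)"
          by (rule bounded_linear.has_derivative[OF bounded_linear_proj[OF I]])
        then have "(h J has_derivative (\<lambda>w. proj I (D * J) * w)) (at z)"
          by (simp add: h_def[abs_def] mult.assoc proj_emb_mult[OF I] mult.commute[of _ "proj I _"])
        then show ?thesis unfolding has_field_derivative_def by blast
      qed
      then show ?thesis by (simp add: holomorphic_on_open)
    qed
    then have hs: "(\<lambda>n. (deriv ^^ n) (h J) 0 / fact n * z ^ n) sums h J z" if "norm z < 1" for J z
      using holomorphic_power_series[of "h J" 0 1 z] that by simp
    define c where "c J n = (deriv ^^ n) (h J) 0 / fact n" for J n
    note hs = hs[folded c_def]
    define a where
      "a n = (1/2) *\<^sub>R (\<Sum>J\<in>Basis. emb I (c J n) * inverse J)" for n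
    have "(\<lambda>n. emb I z ^ n * a n) sums f (emb I z)" if "norm z < 1" for z
    proof -
      have "(\<lambda>n. emb I (c J n * z ^ n) * inverse J)
          sums (emb I (h J z) * inverse J)" for J
        by (intro sums_mult2 bounded_linear.sums[OF bounded_linear_emb[OF I]] hs that)
      then have "(\<lambda>n. (1/2) *\<^sub>R (\<Sum>J\<in>Basis. emb I (c J n * z ^ n) * inverse J))
          sums ((1/2) *\<^sub>R (\<Sum>J\<in>Basis. emb I (h J z) * inverse J))"
        by (intro bounded_linear.sums[OF bounded_linear_scaleR_right] sums_sum)
      moreover have "(1/2) *\<^sub>R (\<Sum>J\<in>Basis. emb I (h J z) * inverse J) = f (emb I z)"
        unfolding h_def slice_expansion[OF I, symmetric] by simp
      moreover have "(1/2) *\<^sub>R (\<Sum>J\<in>Basis. emb I (c J n * z ^ n) * inverse J)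
          = emb I z ^ n * a n" for n
        unfolding a_def mult.commute[of _ "z ^ n"]
        by (simp add: emb_mult[OF I] emb_power[OF I] sum_distrib_left mult.assoc)
      ultimately show ?thesis by simp
    qed
    then show "\<exists>a. \<forall>z. norm z < 1 \<longrightarrow> (\<lambda>n. emb I z ^ n * a n) sums f (emb I z)" by blast
  qed
  from bchoice[OF ex] obtain A where
    A: "\<And>I z. I \<in> qS \<Longrightarrow> norm z < 1 \<Longrightarrow> (\<lambda>n. emb I z ^ n * A I n) sums f (emb I z)"
    by blast
  obtain I0 where I0: "I0 \<in> qS" using qS_nonempty by blast
  have A0: "A I = A I0" if "I \<in> qS" for I
  proof (rule qseries_unique_real)
    fix x :: real assume "\<bar>x\<bar> < 1"
    then show "(\<lambda>n. of_real x ^ n * A I n) sums f (of_real x)"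
      "(\<lambda>n. of_real x ^ n * A I0 n) sums f (of_real x)"
      using A[OF that, of "of_real x"] A[OF I0, of "of_real x"] by simp_all
  qed
  have "qseries f (A I0)"
    unfolding qseries_def
  proof
    fix q assume "q \<in> qB"
    obtain I z where "I \<in> qS" "q = emb I z" "norm z = norm q" by (rule quat_in_slice)
    with A[of I z] \<open>q \<in> qB\<close> A0 show "(\<lambda>n. q ^ n * A I0 n) sums f q" by (simp add: qB_iff)
  qed
  then show thesis by (rule that)
qed

lemma qseries_proj_sums:
  assumes "qseries f a" "I \<in> qS" "norm z < 1"
  shows "(\<lambda>n. proj I (a n * J) * z ^ n) sums proj I (f (emb I z) * J)"
proof -
  have "(\<lambda>n. emb I z ^ n * a n) sums f (emb I z)"
    using assms emb_in_qB[of I z] unfolding qseries_def by blast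
  then have "(\<lambda>n. emb I z ^ n * a n * J) sums (f (emb I z) * J)"
    by (rule sums_mult2)
  then have "(\<lambda>n. proj I (emb I z ^ n * a n * J)) sums proj I (f (emb I z) * J)"
    by (rule bounded_linear.sums[OF bounded_linear_proj[OF assms(2)]])
  then show ?thesis
    by (simp add: mult.assoc proj_emb_mult[OF assms(2)] mult.commute[of _ "proj I _"]
        flip: emb_power[OF assms(2)])
qed

lemma qseries_proj_holomorphic:
  assumes "qseries f a" "I \<in> qS"
  shows "(\<lambda>z. proj I (f (emb I z) * J)) holomorphic_on ball 0 1"
  using power_series_holomorphic[of 0 1 "\<lambda>n. proj I (a n * J)" "\<lambda>z. proj I (f (emb I z) * J)"]
    qseries_proj_sums[OF assms] by simp

lemma qseries_imp_slice_regular: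
  assumes "qseries f a"
  shows "slice_regular f qB"
proof (rule slice_regularI)
  define h where "h I J z = proj I (f (emb I z) * J)" for I J z
  define D where "D I z = (1/2) *\<^sub>R (\<Sum>J\<in>Basis. emb I (deriv (h I J) z) * inverse J)" for I z
  fix I assume I: "I \<in> qS"
  have hol: "h I J holomorphic_on ball 0 1" for J
    unfolding h_def by (rule qseries_proj_holomorphic[OF assms I])
  have f: "(\<lambda>z. f (emb I z)) = (\<lambda>z. (1/2) *\<^sub>R (\<Sum>J\<in>Basis. emb I (h I J z) * inverse J))"
    unfolding h_def slice_expansion[OF I, symmetric] by simp
  show "continuous_on (ball 0 1) (D I)"
    unfolding D_def
    by (intro continuous_intros bounded_linear.continuous_on[OF bounded_linear_emb[OF I]]
        holomorphic_on_imp_continuous_on holomorphic_deriv hol open_ball)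
  fix z :: complex assume z: "norm z < 1"
  have "(h I J has_derivative (\<lambda>w. deriv (h I J) z * w)) (at z)" for J
    using holomorphic_derivI[OF hol open_ball] z by (simp add: has_field_derivative_def)
  then have "((\<lambda>z. emb I (h I J z) * inverse J) has_derivative
      (\<lambda>w. emb I (deriv (h I J) z * w) * inverse J)) (at z)" for J
    by (intro bounded_linear.has_derivative[OF bounded_linear_mult_left]
        bounded_linear.has_derivative[OF bounded_linear_emb[OF I]])
  then have "((\<lambda>z. f (emb I z)) has_derivative
      (\<lambda>w. (1/2) *\<^sub>R (\<Sum>J\<in>Basis. emb I (deriv (h I J) z * w) * inverse J))) (at z)"
    unfolding f
    by (intro bounded_linear.has_derivative[OF bounded_linear_scaleR_right] has_derivative_sum)
  moreover have "(1/2) *\<^sub>R (\<Sum>J\<in>Basis. emb I (deriv (h I J) z * w) * inverse J) = emb I w * D I z" for w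
    unfolding D_def mult.commute[of _ w]
    by (simp add: emb_mult[OF I] sum_distrib_left mult.assoc)
  ultimately show "((\<lambda>w. f (emb I w)) has_derivative (\<lambda>w. emb I w * D I z)) (at z)" by simp
qed

lemma qseries_coeffs: "slice_regular f qB \<Longrightarrow> qseries f (coeffs f)"
  by (erule slice_regular_imp_qseries) (simp add: coeffs_eqI)

section \<open>Integral means on circles are increasing\<close>

definition slice_mean :: "real \<Rightarrow> (quat \<Rightarrow> quat) \<Rightarrow> quat \<Rightarrow> real \<Rightarrow> real" where
  "slice_mean p f I r =
     1 / (2 * pi) * integral {-pi..pi} (\<lambda>t. norm (f (emb I (of_real r * cis t))) powr p)"

text \<open>The derivative of \<open>x powr p\<close>; the case distinction makes it continuous at \<open>0\<close>, where
  \<open>0 powr 0 = 0\<close>.\<close>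

definition powr_slope :: "real \<Rightarrow> real \<Rightarrow> real" where
  "powr_slope p s = (if p = 1 then 1 else p * s powr (p - 1))"

lemma powr_slope_nonneg: "1 \<le> p \<Longrightarrow> 0 \<le> powr_slope p s"
  by (simp add: powr_slope_def)

lemma powr_above_tangent:
  fixes p x s :: real
  assumes "1 \<le> p" "0 \<le> x" "0 \<le> s"
  shows "s powr p + powr_slope p s * (x - s) \<le> x powr p"
proof (cases "p = 1 \<or> s = 0 \<or> x = 0")
  case True
  have "s powr p \<le> p * (s powr (p - 1) * s)"
  proof (cases "s = 0")
    case False
    then have "s powr p = s powr (p - 1) * s" using assms by (simp add: powr_diff)
    moreover have "1 * s powr p \<le> p * s powr p" using assms by (intro mult_right_mono) auto
    ultimately show ?thesis by simp
  qed simp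
  with True show ?thesis
    using assms by (auto simp: powr_slope_def)
next
  case False
  have "x powr p - s powr p \<ge> (p * s powr (p - 1)) * (x - s)"
  proof (rule convex_on_imp_above_tangent[OF powr_convex[OF assms(1)]])
    show "((\<lambda>x. x powr p) has_field_derivative p * s powr (p - 1)) (at s within {0<..})"
      using False assms by (auto intro!: derivative_eq_intros)
  qed (use False assms in \<open>auto simp: interior_open\<close>)
  with False show ?thesis by (simp add: powr_slope_def)
qed

lemma norm_powr_above_tangent:
  fixes v w :: "'a::real_inner"
  assumes "1 \<le> p" "0 < \<epsilon>"
  shows "norm v powr p + inner (w - v) ((powr_slope p (norm v) / (norm v + \<epsilon>)) *\<^sub>R v)
      - \<epsilon> * powr_slope p (norm v) \<le> norm w powr p"
proof -
  define c where "c = powr_slope p (norm v)"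
  have c: "0 \<le> c" using powr_slope_nonneg[OF assms(1)] by (simp add: c_def)
  have pos: "0 < norm v + \<epsilon>" using assms(2) norm_ge_zero[of v] by linarith
  have "inner w v \<le> norm w * norm v" by (rule norm_cauchy_schwarz)
  also have "\<dots> \<le> norm w * (norm v + \<epsilon>)"
    using assms(2) by (intro mult_left_mono) auto
  finally have w: "inner w v / (norm v + \<epsilon>) \<le> norm w"
    using pos by (simp add: pos_divide_le_eq)
  have "(norm v - \<epsilon>) * (norm v + \<epsilon>) \<le> inner v v"
    using assms(2) by (simp add: algebra_simps power2_norm_eq_inner[symmetric] power2_eq_square)
  then have v: "norm v - \<epsilon> \<le> inner v v / (norm v + \<epsilon>)"
    using pos by (simp add: pos_le_divide_eq)
  have "inner (w - v) ((c / (norm v + \<epsilon>)) *\<^sub>R v)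
      = c * (inner w v / (norm v + \<epsilon>) - inner v v / (norm v + \<epsilon>))"
    by (simp add: inner_diff_left algebra_simps diff_divide_distrib)
  also have "\<dots> \<le> c * (norm w - (norm v - \<epsilon>))"
    using w v c by (intro mult_left_mono) auto
  finally have "inner (w - v) ((c / (norm v + \<epsilon>)) *\<^sub>R v) - \<epsilon> * c \<le> c * (norm w - norm v)"
    by (simp add: algebra_simps)
  moreover have "norm v powr p + c * (norm w - norm v) \<le> norm w powr p"
    unfolding c_def using assms by (intro powr_above_tangent) auto
  ultimately show ?thesis unfolding c_def by linarith
qed

lemma integral_circle_rotate:
  fixes g :: "complex \<Rightarrow> 'b::banach"
  assumes cont: "continuous_on (sphere 0 1) g" and w: "norm w = 1"
  shows "integral {-pi..pi} (\<lambda>t. g (w * cis t)) = integral {-pi..pi} (\<lambda>t. g (cis t))"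
proof -
  define s where "s = Arg2pi w"
  have s: "0 \<le> s" "s \<le> 2 * pi" using Arg2pi[of w] by (auto simp: s_def)
  have w: "w = cis s" using Arg2pi[of w] w by (simp add: s_def cis_conv_exp is_Arg_def)
  have contg: "continuous_on A (\<lambda>t. g (cis t))" for A
    by (rule continuous_on_compose2[OF cont]) (auto intro!: continuous_intros)
  then have int: "(\<lambda>t. g (cis t)) integrable_on {a..b}" for a b
    by (rule integrable_continuous_real)
  have "integral {-pi..pi} (\<lambda>t. g (w * cis t)) = integral {-pi + s - s..pi + s - s} (\<lambda>t. g (cis (t + s)))"
    by (simp add: w cis_mult add.commute)
  also have "\<dots> = integral {-pi + s..pi + s} (\<lambda>t. g (cis t))"
    by (rule integral_shift_real_ivl)
  also have "\<dots> = integral {-pi + s..pi} (\<lambda>t. g (cis t)) + integral {pi..pi + s} (\<lambda>t. g (cis t))"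
    by (rule Henstock_Kurzweil_Integration.integral_combine[symmetric]) (use s int in auto)
  also have "integral {pi..pi + s} (\<lambda>t. g (cis t)) = integral {pi - 2 * pi..pi + s - 2 * pi} (\<lambda>t. g (cis (t + 2 * pi)))"
    by (rule integral_shift_real_ivl[symmetric])
  also have "\<dots> = integral {-pi..-pi + s} (\<lambda>t. g (cis t))"
    by (simp add: cis_mult[symmetric])
  also have "integral {-pi + s..pi} (\<lambda>t. g (cis t)) + \<dots> = integral {-pi..pi} (\<lambda>t. g (cis t))"
    by (subst add.commute, rule Henstock_Kurzweil_Integration.integral_combine) (use s int in auto)
  finally show ?thesis .
qed

lemma holomorphic_circle_integral:
  assumes hol: "h holomorphic_on ball 0 1" and cont: "continuous_on {-pi..pi} \<gamma>"
  shows "(\<lambda>z. integral (cbox (-pi) pi) (\<lambda>t. h (z * cis t) * \<gamma> t)) holomorphic_on ball 0 1"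
proof (rule leibniz_rule_holomorphic[where fx = "\<lambda>z t. deriv h (z * cis t) * cis t * \<gamma> t"])
  fix z t assume z: "z \<in> ball (0::complex) 1" and "t \<in> cbox (-pi) pi"
  have "(h has_field_derivative deriv h (z * cis t)) (at (z * cis t))"
    using z by (intro holomorphic_derivI[OF hol]) (auto simp: norm_mult)
  then have "((\<lambda>z. h (z * cis t)) has_field_derivative deriv h (z * cis t) * cis t) (at z)"
    by (rule DERIV_chain2) (auto intro!: derivative_eq_intros)
  then show "((\<lambda>z. h (z * cis t) * \<gamma> t) has_field_derivative deriv h (z * cis t) * cis t * \<gamma> t)
      (at z within ball 0 1)"
    by (auto intro!: derivative_eq_intros intro: has_field_derivative_at_within)
next
  fix z assume z: "z \<in> ball (0::complex) 1"
  have "continuous_on (cbox (-pi) pi) (\<lambda>t. h (z * cis t))"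
    by (rule continuous_on_compose2[OF holomorphic_on_imp_continuous_on[OF hol]])
      (use z in \<open>auto intro!: continuous_intros simp: norm_mult\<close>)
  then show "(\<lambda>t. h (z * cis t) * \<gamma> t) integrable_on cbox (-pi) pi"
    using cont by (intro integrable_continuous continuous_intros) auto
next
  have "continuous_on (ball 0 1 \<times> cbox (-pi) pi) (\<lambda>x. deriv h (fst x * cis (snd x)))"
    by (rule continuous_on_compose2[OF holomorphic_on_imp_continuous_on[OF
          holomorphic_deriv[OF hol open_ball]]])
      (auto intro!: continuous_intros simp: norm_mult)
  moreover have "continuous_on (ball 0 1 \<times> cbox (-pi) pi) (\<lambda>x. \<gamma> (snd x))"
    by (rule continuous_on_compose2[OF cont]) (auto intro!: continuous_intros)
  ultimately show "continuous_on (ball 0 1 \<times> cbox (-pi) pi)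
      (\<lambda>(z, t). deriv h (z * cis t) * cis t * \<gamma> t)"
    unfolding case_prod_beta by (intro continuous_intros)
qed auto

definition qcnj :: "quat \<Rightarrow> quat" where
  "qcnj q = (2 * inner q 1) *\<^sub>R 1 - q"

lemma quat_inner_eq: "inner w g = quat.Re (w * qcnj g)"
  by (simp add: inner_quat_def qcnj_def)

lemma continuous_on_qcnj [continuous_intros]:
  "continuous_on S f \<Longrightarrow> continuous_on S (\<lambda>x. qcnj (f x))"
  unfolding qcnj_def by (intro continuous_intros)

lemma qseries_continuous_on_slice:
  assumes "qseries f a" "I \<in> qS"
  shows "continuous_on (ball 0 1) (\<lambda>z. f (emb I z))"
proof -
  have "\<exists>D. ((\<lambda>w. f (emb I w)) has_derivative (\<lambda>w. emb I w * D)) (at z)" if "z \<in> ball 0 1" for z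
    using slice_regular_has_derivative[OF qseries_imp_slice_regular[OF assms(1)] assms(2)] that by simp
  then show ?thesis
    by (meson has_derivative_continuous continuous_at_imp_continuous_on)
qed

lemma continuous_on_circle:
  assumes "qseries f a" "I \<in> qS" "norm z < 1"
  shows "continuous_on A (\<lambda>t. f (emb I (z * cis t)))"
  by (rule continuous_on_compose2[OF qseries_continuous_on_slice[OF assms(1,2)]])
    (use assms(3) in \<open>auto intro!: continuous_intros simp: norm_mult\<close>)

lemma continuous_on_circle_powr:
  assumes "qseries f a" "I \<in> qS" "norm z < 1" "1 \<le> p"
  shows "continuous_on A (\<lambda>t. norm (f (emb I (z * cis t))) powr p)"
  using assms by (intro continuous_on_powr' continuous_on_norm continuous_on_circle continuous_intros) auto

lemma circle_pairing_holomorphic: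
  assumes f: "qseries f a" and I: "I \<in> qS" and G: "continuous_on {-pi..pi} G"
  shows "(\<lambda>z. integral {-pi..pi} (\<lambda>t. proj I (f (emb I (z * cis t)) * G t))) holomorphic_on ball 0 1"
proof -
  define h where "h J z = proj I (f (emb I z) * J)" for J z
  have hol: "h J holomorphic_on ball 0 1" for J
    unfolding h_def by (rule qseries_proj_holomorphic[OF f I])
  define \<gamma> where "\<gamma> J t = proj I (inverse J * G t) / 2" for J t
  have \<gamma>: "continuous_on {-pi..pi} (\<gamma> J)" for J
    unfolding \<gamma>_def
    by (intro continuous_intros bounded_linear.continuous_on[OF bounded_linear_proj[OF I]] G) auto
  have eq: "proj I (f (emb I z) * G t) = (\<Sum>J\<in>Basis. h J z * \<gamma> J t)" for z t
  proof -
    interpret proj: bounded_linear "proj I" by (rule bounded_linear_proj[OF I])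
    have "proj I (2 *\<^sub>R f (emb I z) * G t) = (\<Sum>J\<in>Basis. h J z * proj I (inverse J * G t))"
      by (simp add: slice_expansion[OF I] sum_distrib_right proj.sum mult.assoc proj_emb_mult[OF I] h_def
          del: mult_scaleR_left)
    moreover have "proj I (2 *\<^sub>R f (emb I z) * G t) = 2 *\<^sub>R proj I (f (emb I z) * G t)"
      by (simp only: mult_scaleR_left proj.scaleR)
    moreover have "(\<Sum>J\<in>Basis. h J z * \<gamma> J t) = (\<Sum>J\<in>Basis. h J z * proj I (inverse J * G t)) / 2"
      by (simp add: \<gamma>_def sum_divide_distrib)
    ultimately show ?thesis by (simp add: scaleR_conv_of_real)
  qed
  have "(\<lambda>z. \<Sum>J\<in>Basis. integral (cbox (-pi) pi) (\<lambda>t. h J (z * cis t) * \<gamma> J t)) holomorphic_on ball 0 1"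
    by (intro holomorphic_intros holomorphic_circle_integral hol \<gamma>)
  then show ?thesis
  proof (rule holomorphic_transform)
    fix z :: complex assume z: "z \<in> ball 0 1"
    have "continuous_on (cbox (-pi) pi) (\<lambda>t. h J (z * cis t))" for J
      by (rule continuous_on_compose2[OF holomorphic_on_imp_continuous_on[OF hol]])
        (use z in \<open>auto intro!: continuous_intros simp: norm_mult\<close>)
    then have "(\<lambda>t. h J (z * cis t) * \<gamma> J t) integrable_on {-pi..pi}" for J
      using \<gamma> by (intro integrable_continuous_real continuous_intros) auto
    then show "(\<Sum>J\<in>Basis. integral (cbox (-pi) pi) (\<lambda>t. h J (z * cis t) * \<gamma> J t))
        = integral {-pi..pi} (\<lambda>t. proj I (f (emb I (z * cis t)) * G t))"
      unfolding eq by (subst integral_sum) auto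
  qed
qed

lemma slice_mean_rotate:
  assumes "qseries f a" "I \<in> qS" "norm z < 1" "1 \<le> p"
  shows "slice_mean p f I (norm z) = 1 / (2 * pi) *
    integral {-pi..pi} (\<lambda>t. norm (f (emb I (z * cis t))) powr p)"
proof (cases "z = 0")
  case False
  define g where "g w = norm (f (emb I (of_real (norm z) * w))) powr p" for w
  have "continuous_on (sphere 0 1) (\<lambda>w. f (emb I (of_real (norm z) * w)))"
    by (rule continuous_on_compose2[OF qseries_continuous_on_slice[OF assms(1,2)]])
      (use assms(3) in \<open>auto intro!: continuous_intros simp: norm_mult\<close>)
  then have "continuous_on (sphere 0 1) g"
    unfolding g_def using assms(4)
    by (intro continuous_on_powr' continuous_on_norm continuous_intros) auto
  moreover have "norm (sgn z) = 1" using False by (simp add: norm_sgn)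
  ultimately have "integral {-pi..pi} (\<lambda>t. g (sgn z * cis t)) = integral {-pi..pi} (\<lambda>t. g (cis t))"
    by (rule integral_circle_rotate)
  with False show ?thesis by (simp add: slice_mean_def g_def sgn_eq)
qed (simp add: slice_mean_def)

text \<open>The tangent plane to \<open>norm v powr p\<close> along the inner circle bounds the difference of the two
  means from below by the real part of a holomorphic function, to which the maximum principle applies.\<close>

lemma slice_mean_mono:
  assumes f: "qseries f a" and I: "I \<in> qS" and p: "1 \<le> p" and r: "0 \<le> r" "r \<le> s" "s < 1"
  shows "slice_mean p f I r \<le> slice_mean p f I s"
proof -
  define F where "F z t = f (emb I (z * cis t))" for z t
  have contF: "continuous_on {-pi..pi} (F z)" if "norm z < 1" for z
    unfolding F_def using continuous_on_circle[OF f I that] .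
  define N where "N z = integral {-pi..pi} (\<lambda>t. norm (F z t) powr p)" for z
  have Nint: "(\<lambda>t. norm (F z t) powr p) integrable_on {-pi..pi}" if "norm z < 1" for z
    unfolding F_def by (rule integrable_continuous_real[OF continuous_on_circle_powr[OF f I that p]])
  define v where "v = F (of_real r)"
  have contv: "continuous_on {-pi..pi} v" unfolding v_def using r by (intro contF) simp
  define c where "c t = powr_slope p (norm (v t))" for t
  have contc: "continuous_on {-pi..pi} c"
  proof (cases "p = 1")
    case False
    with p have "continuous_on {-pi..pi} (\<lambda>t. p * norm (v t) powr (p - 1))"
      by (intro continuous_intros continuous_on_powr' contv) auto
    then show ?thesis using False by (simp add: c_def[abs_def] powr_slope_def)
  qed (simp add: c_def[abs_def] powr_slope_def)
  have c0: "0 \<le> c t" for t unfolding c_def by (rule powr_slope_nonneg[OF p])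
  define C where "C = integral {-pi..pi} c"
  have C: "0 \<le> C" unfolding C_def using contc c0 by (intro integral_nonneg integrable_continuous_real)
  have main: "N (of_real r) \<le> N (of_real s) + \<epsilon> * C" if \<epsilon>: "0 < \<epsilon>" for \<epsilon>
  proof -
    define g where "g t = (c t / (norm (v t) + \<epsilon>)) *\<^sub>R v t" for t
    have pos: "norm (v t) + \<epsilon> \<noteq> 0" for t using \<epsilon> norm_ge_zero[of "v t"] by linarith
    have contg: "continuous_on {-pi..pi} g"
      unfolding g_def using pos by (intro continuous_intros contc contv) auto
    define H where "H z = integral {-pi..pi} (\<lambda>t. proj I (F z t * qcnj (g t)))" for z
    have hol: "H holomorphic_on ball 0 1"
      unfolding H_def F_def by (intro circle_pairing_holomorphic[OF f I] continuous_on_qcnj contg)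
    have inn: "(\<lambda>t. inner (F z t) (g t)) integrable_on {-pi..pi}"
      and ReH: "complex.Re (H z) = integral {-pi..pi} (\<lambda>t. inner (F z t) (g t))" if "norm z < 1" for z
    proof -
      show "(\<lambda>t. inner (F z t) (g t)) integrable_on {-pi..pi}"
        using that by (intro integrable_continuous_real continuous_on_inner contF contg)
      have "(\<lambda>t. proj I (F z t * qcnj (g t))) integrable_on {-pi..pi}"
        using that by (intro integrable_continuous_real
          bounded_linear.continuous_on[OF bounded_linear_proj[OF I]] continuous_intros contF contg)
      from integral_linear[OF this bounded_linear_Re]
      show "complex.Re (H z) = integral {-pi..pi} (\<lambda>t. inner (F z t) (g t))"
        by (simp add: H_def o_def quat_inner_eq)
    qed
    have bound: "complex.Re (H z) \<le> complex.Re (H (of_real r)) - N (of_real r) + \<epsilon> * C + N z"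
      if z: "norm z < 1" for z
    proof -
      have "norm (v t) powr p + (inner (F z t) (g t) - inner (v t) (g t)) - \<epsilon> * c t \<le> norm (F z t) powr p" for t
        using norm_powr_above_tangent[OF p \<epsilon>, of "v t" "F z t", folded c_def, folded g_def]
        by (simp add: inner_diff_left)
      moreover have r1: "norm (of_real r :: complex) < 1" using r by simp
      ultimately have "integral {-pi..pi} (\<lambda>t. norm (v t) powr p + (inner (F z t) (g t) - inner (v t) (g t)) - \<epsilon> * c t)
          \<le> N z"
        unfolding N_def
        by (intro integral_le integrable_diff integrable_add Nint z inn integrable_on_mult_right
            integrable_continuous_real[OF contc]) (use Nint[OF r1] inn[OF r1] in \<open>auto simp: v_def\<close>)
      also have "integral {-pi..pi} (\<lambda>t. norm (v t) powr p + (inner (F z t) (g t) - inner (v t) (g t)) - \<epsilon> * c t)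
          = N (of_real r) + (complex.Re (H z) - complex.Re (H (of_real r))) - \<epsilon> * C"
        using Nint[OF r1] inn[OF r1] inn[OF z] integrable_continuous_real[OF contc]
        by (simp add: ReH[OF z] ReH[OF r1] N_def C_def v_def integral_diff integral_add integrable_diff integrable_add
            integrable_on_mult_right)
      finally show ?thesis by simp
    qed
    have "complex.Re (H (of_real r)) \<le> complex.Re (H (of_real r)) - N (of_real r) + \<epsilon> * C + N (of_real s)"
    proof (rule maximum_real_frontier[where f = H and S = "cball 0 s" and \<xi> = "of_real r"])
      show "H holomorphic_on interior (cball 0 s)"
        using hol by (rule holomorphic_on_subset) (use r in auto)
      show "continuous_on (closure (cball 0 s)) H"
        using holomorphic_on_imp_continuous_on[OF hol] by (rule continuous_on_subset) (use r in auto)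
      fix z :: complex assume "z \<in> frontier (cball 0 s)"
      then have z: "norm z = s" using r by simp
      then have "N z = N (of_real s)"
        using slice_mean_rotate[OF f I _ p, of z] slice_mean_rotate[OF f I _ p, of "of_real s"] r
        by (simp add: N_def F_def)
      with bound[of z] z r
      show "complex.Re (H z) \<le> complex.Re (H (of_real r)) - N (of_real r) + \<epsilon> * C + N (of_real s)"
        by simp
    qed (use r in auto)
    then show ?thesis by simp
  qed
  have "N (of_real r) \<le> N (of_real s)"
  proof (rule field_le_epsilon)
    fix e :: real assume e: "0 < e"
    have "N (of_real r) \<le> N (of_real s) + e / (C + 1) * C"
      using e C by (intro main) auto
    also have "e / (C + 1) * C \<le> e" using e C by (simp add: field_simps)
    finally show "N (of_real r) \<le> N (of_real s) + e" by simp
  qed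
  then show ?thesis by (simp add: slice_mean_def N_def F_def divide_right_mono)
qed

section \<open>Coefficients and Hardy norms\<close>

lemma integral_circle_monomial:
  "integral {-pi..pi} (\<lambda>t. cis t ^ m * cnj (cis t) ^ n) = (if m = n then 2 * pi else 0)"
proof (cases "m = n")
  case True
  have "cis t ^ n * cnj (cis t) ^ n = 1" for t
    by (simp flip: power_mult_distrib add: complex_norm_square[symmetric])
  then show ?thesis using True by (simp add: scaleR_conv_of_real)
next
  case False
  define w where "w = cis (pi / (real m - real n))"
  define g where "g z = z ^ m * cnj z ^ n" for z :: complex
  define X where "X = integral {-pi..pi} (\<lambda>t. g (cis t))"
  have "w ^ m * cnj w ^ n = cis (real m * (pi / (real m - real n)) - real n * (pi / (real m - real n)))"
    by (simp add: w_def Complex.DeMoivre cis_cnj cis_mult)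
  also have "real m * (pi / (real m - real n)) - real n * (pi / (real m - real n)) = pi"
    unfolding left_diff_distrib[symmetric] using False by simp
  finally have w: "w ^ m * cnj w ^ n = -1" by simp
  have "integral {-pi..pi} (\<lambda>t. g (w * cis t)) = X"
    unfolding X_def g_def by (intro integral_circle_rotate continuous_intros) (simp add: w_def)
  moreover have "g (w * cis t) = - g (cis t)" for t
  proof -
    have "g (w * cis t) = (w ^ m * cnj w ^ n) * g (cis t)"
      by (simp add: g_def power_mult_distrib)
    then show ?thesis by (simp only: w mult_minus1)
  qed
  ultimately have "X = 0" by (simp add: X_def)
  with False show ?thesis by (simp add: X_def g_def)
qed

lemma coeff_circle_integral:
  assumes f: "qseries f a" and I: "I \<in> qS" and r: "0 \<le> r" "r < 1"
  shows "((\<lambda>t. emb I (cnj (cis t) ^ n) * f (emb I (of_real r * cis t))) has_integral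
      (2 * pi * r ^ n) *\<^sub>R a n) {-pi..pi}"
proof -
  define g where "g m t = emb I (of_real (r ^ m) * (cis t ^ m * cnj (cis t) ^ n)) * a m" for m t
  have gint: "(g m has_integral (if m = n then (2 * pi * r ^ n) *\<^sub>R a n else 0)) {-pi..pi}" for m
  proof -
    have "((\<lambda>t. cis t ^ m * cnj (cis t) ^ n) has_integral (if m = n then of_real (2 * pi) else 0)) {-pi..pi}"
      using integrable_integral[OF integrable_continuous_real[of "-pi" pi "\<lambda>t. cis t ^ m * cnj (cis t) ^ n"]]
      by (simp add: integral_circle_monomial continuous_intros split: if_splits)
    then have "((\<lambda>t. of_real (r ^ m) * (cis t ^ m * cnj (cis t) ^ n)) has_integral
        of_real (r ^ m) * (if m = n then of_real (2 * pi) else 0)) {-pi..pi}"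
      by (rule has_integral_mult_right)
    from has_integral_linear[OF has_integral_linear[OF this bounded_linear_emb[OF I]]
        bounded_linear_mult_left[of "a m"]]
    have "(g m has_integral emb I (of_real (r ^ m) * (if m = n then of_real (2 * pi) else 0)) * a m) {-pi..pi}"
      by (simp add: g_def[abs_def] o_def)
    moreover have "emb I (of_real (r ^ m) * (if m = n then of_real (2 * pi) else 0)) * a m
        = (if m = n then (2 * pi * r ^ n) *\<^sub>R a n else 0)"
      by (auto simp: scaleR_conv_of_real mult.commute simp flip: of_real_mult of_real_power)
    ultimately show ?thesis by simp
  qed
  have geq: "g m t = emb I (cnj (cis t) ^ n) * (emb I (of_real r * cis t) ^ m * a m)" for m t
    unfolding g_def mult.assoc[symmetric] emb_power[OF I, symmetric] emb_mult[OF I, symmetric]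
    by (simp add: power_mult_distrib mult_ac)
  have gsum: "(\<lambda>m. g m t) sums (emb I (cnj (cis t) ^ n) * f (emb I (of_real r * cis t)))" for t
    unfolding geq
  proof (rule sums_mult)
    have "emb I (of_real r * cis t) \<in> qB" using I r by (simp add: emb_in_qB norm_mult)
    then show "(\<lambda>m. emb I (of_real r * cis t) ^ m * a m) sums f (emb I (of_real r * cis t))"
      using f by (simp add: qseries_def)
  qed
  have "norm (g m t) \<le> r ^ m * norm (a m)" for m t
    using r by (simp add: g_def norm_mult norm_emb[OF I] norm_power)
  then have "uniform_limit {-pi..pi} (\<lambda>N t. \<Sum>m<N. g m t) (\<lambda>t. suminf (\<lambda>m. g m t)) sequentially"
    by (rule Weierstrass_m_test) (rule qseries_abs_summable[OF f r])
  then have ul: "uniform_limit {-pi..pi} (\<lambda>N t. \<Sum>m<N. g m t)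
      (\<lambda>t. emb I (cnj (cis t) ^ n) * f (emb I (of_real r * cis t))) sequentially"
    by (simp add: gsum[THEN sums_unique, symmetric])
  have gc: "continuous_on {-pi..pi} (g m)" for m
    unfolding g_def
    by (intro bounded_linear.continuous_on[OF bounded_linear_emb[OF I]] continuous_intros)
  obtain P J where P: "\<And>N. ((\<lambda>t. \<Sum>m<N. g m t) has_integral P N) {-pi..pi}"
    and J: "((\<lambda>t. emb I (cnj (cis t) ^ n) * f (emb I (of_real r * cis t))) has_integral J) {-pi..pi}"
    and lim: "P \<longlonglongrightarrow> J"
    by (rule uniform_limit_integral[OF ul]) (auto intro!: continuous_intros gc)
  have "P N = (\<Sum>m<N. if m = n then (2 * pi * r ^ n) *\<^sub>R a n else 0)" for N
    by (rule has_integral_unique[OF P]) (intro has_integral_sum gint, simp)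
  then have "P N = (2 * pi * r ^ n) *\<^sub>R a n" if "N \<ge> Suc n" for N
    using that by simp
  then have "\<forall>\<^sub>F N in sequentially. P N = (2 * pi * r ^ n) *\<^sub>R a n"
    unfolding eventually_sequentially by blast
  then have "P \<longlonglongrightarrow> (2 * pi * r ^ n) *\<^sub>R a n" by (rule tendsto_eventually)
  with lim have "J = (2 * pi * r ^ n) *\<^sub>R a n" by (rule LIMSEQ_unique)
  with J show ?thesis by simp
qed

lemma coeff_le_slice_mean:
  assumes f: "qseries f a" and I: "I \<in> qS" and r: "0 \<le> r" "r < 1"
  shows "r ^ n * norm (a n) \<le> slice_mean 1 f I r"
proof -
  have "norm (integral {-pi..pi} (\<lambda>t. emb I (cnj (cis t) ^ n) * f (emb I (of_real r * cis t))))
      \<le> integral {-pi..pi} (\<lambda>t. norm (f (emb I (of_real r * cis t))) powr 1)"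
  proof (rule integral_norm_bound_integral)
    show "(\<lambda>t. emb I (cnj (cis t) ^ n) * f (emb I (of_real r * cis t))) integrable_on {-pi..pi}"
      using coeff_circle_integral[OF assms] by blast
    show "(\<lambda>t. norm (f (emb I (of_real r * cis t))) powr 1) integrable_on {-pi..pi}"
      using r by (intro integrable_continuous_real continuous_on_circle_powr[OF f I]) auto
  qed (simp add: norm_mult norm_emb[OF I] norm_power)
  also have "integral {-pi..pi} (\<lambda>t. emb I (cnj (cis t) ^ n) * f (emb I (of_real r * cis t)))
      = (2 * pi * r ^ n) *\<^sub>R a n"
    using coeff_circle_integral[OF assms] by (rule integral_unique)
  also have "norm \<dots> = 2 * pi * (r ^ n * norm (a n))"
    using r by (simp add: abs_mult)
  finally have "2 * pi * (r ^ n * norm (a n))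
      \<le> integral {-pi..pi} (\<lambda>t. norm (f (emb I (of_real r * cis t))) powr 1)"
    .
  then show ?thesis by (simp add: slice_mean_def field_simps)
qed

lemma slice_mean_nonneg: "0 \<le> slice_mean p f I r"
proof -
  have "0 \<le> integral {-pi..pi} (\<lambda>t. norm (f (emb I (of_real r * cis t))) powr p)"
    by (cases "(\<lambda>t. norm (f (emb I (of_real r * cis t))) powr p) integrable_on {-pi..pi}")
      (auto intro: integral_nonneg simp: not_integrable_integral)
  then show ?thesis by (simp add: slice_mean_def)
qed

lemma slice_mean_1_le:
  assumes f: "qseries f a" and I: "I \<in> qS" and r: "0 \<le> r" "r < 1" and p: "1 \<le> p"
  shows "slice_mean 1 f I r \<le> slice_mean p f I r powr (1 / p)"
proof -
  define A where "A = slice_mean 1 f I r"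
  define F where "F t = norm (f (emb I (of_real r * cis t)))" for t
  have A0: "0 \<le> A" unfolding A_def by (rule slice_mean_nonneg)
  have int1: "F integrable_on {-pi..pi}"
    unfolding F_def using r
    by (intro integrable_continuous_real continuous_on_norm continuous_on_circle[OF f I]) auto
  have intp: "(\<lambda>t. F t powr p) integrable_on {-pi..pi}"
    unfolding F_def using r
    by (intro integrable_continuous_real continuous_on_circle_powr[OF f I _ p]) auto
  have A: "integral {-pi..pi} F = 2 * pi * A"
    by (simp add: A_def slice_mean_def F_def[abs_def])
  have "integral {-pi..pi} (\<lambda>t. A powr p + powr_slope p A * (F t - A)) \<le> integral {-pi..pi} (\<lambda>t. F t powr p)"
    by (intro integral_le intp integrable_add integrable_on_mult_right integrable_diff int1
        powr_above_tangent[OF p _ A0]) (auto simp: F_def)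
  also have "integral {-pi..pi} (\<lambda>t. A powr p + powr_slope p A * (F t - A)) = 2 * pi * A powr p"
  proof -
    have const: "((\<lambda>_. k) has_integral 2 * pi * k) {-pi..pi}" for k :: real
      using has_integral_const_real[of k "-pi" pi] by simp
    have "((\<lambda>t. A powr p + powr_slope p A * (F t - A)) has_integral
        (2 * pi * A powr p + powr_slope p A * (2 * pi * A - 2 * pi * A))) {-pi..pi}"
      using integrable_integral[OF int1] unfolding A
      by (intro has_integral_add has_integral_mult_right has_integral_diff const)
    then show ?thesis by (simp add: integral_unique)
  qed
  finally have "A powr p \<le> slice_mean p f I r"
    by (simp add: slice_mean_def F_def field_simps)
  then have "(A powr p) powr (1 / p) \<le> slice_mean p f I r powr (1 / p)"
    using p by (intro powr_mono2) auto
  then show ?thesis using p A0 by (simp add: powr_powr A_def)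
qed

lemma hardy_norm_eq_SUP:
  assumes f: "qseries f a" and p: "1 \<le> p"
  shows "hardy_norm (ereal p) f = (SUP I\<in>qS. SUP r\<in>{0..<1}. ereal (slice_mean p f I r powr (1 / p)))"
proof -
  define m where "m I r = ereal (slice_mean p f I r powr (1 / p))" for I r
  have "Lim (at_left 1) (m I) = (SUP r\<in>{0..<1}. m I r)" if I: "I \<in> qS" for I
  proof (rule tendsto_Lim)
    have mono: "m I r \<le> m I s" if "0 \<le> r" "r \<le> s" "s < 1" for r s
      unfolding m_def ereal_less_eq using p slice_mean_nonneg slice_mean_mono[OF f I p that]
      by (intro powr_mono2) auto
    show "(m I \<longlongrightarrow> (SUP r\<in>{0..<1}. m I r)) (at_left 1)"
    proof (rule increasing_tendsto)
      have "\<forall>\<^sub>F r in at_left 1. (r::real) \<in> {0<..<1}"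
        by (rule eventually_at_leftI[of 0]) auto
      then show "\<forall>\<^sub>F r in at_left 1. m I r \<le> (SUP r\<in>{0..<1}. m I r)"
        by eventually_elim (auto intro: SUP_upper)
      fix x assume "x < (SUP r\<in>{0..<1}. m I r)"
      then obtain s where s: "0 \<le> s" "s < 1" "x < m I s" by (auto simp: less_SUP_iff)
      then have "\<forall>\<^sub>F r in at_left 1. r \<in> {s<..<1}"
        by (intro eventually_at_leftI[of s]) auto
      then show "\<forall>\<^sub>F r in at_left 1. x < m I r"
        by eventually_elim (use mono[of s] s in \<open>auto intro: less_le_trans\<close>)
    qed
  qed simp
  moreover have "emb I (of_real r * cis t) = of_real r * (of_real (cos t) + I * of_real (sin t))" for I r t
    by (simp add: quat_eq_iff emb_def algebra_simps)
  ultimately show ?thesis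
    by (simp add: hardy_norm_def m_def[abs_def] slice_mean_def cong: SUP_cong)
qed

lemma hardy_norm_le_sup:
  assumes f: "qseries f a" and p: "1 \<le> p" and C: "\<And>q. q \<in> qB \<Longrightarrow> norm (f q) \<le> C"
  shows "hardy_norm p f \<le> ereal C"
proof (cases "p = \<infinity>")
  case True
  then show ?thesis using C by (auto simp: hardy_norm_def intro!: SUP_least)
next
  case False
  then obtain p' where p': "p = ereal p'" "1 \<le> p'" using p by (cases p) (auto simp: one_ereal_def)
  have C0: "0 \<le> C" using C[of 0] norm_ge_zero[of "f 0"] by (simp add: qB_iff del: norm_ge_zero)
  have "slice_mean p' f I r powr (1 / p') \<le> C" if I: "I \<in> qS" and r: "r \<in> {0..<1}" for I r
  proof -
    have "integral {-pi..pi} (\<lambda>t. norm (f (emb I (of_real r * cis t))) powr p')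
        \<le> integral {-pi..pi} (\<lambda>t. C powr p')"
    proof (rule integral_le)
      show "(\<lambda>t. norm (f (emb I (of_real r * cis t))) powr p') integrable_on {-pi..pi}"
        using r by (intro integrable_continuous_real continuous_on_circle_powr[OF f I _ p'(2)]) auto
      fix t
      have "emb I (of_real r * cis t) \<in> qB" using r by (simp add: emb_in_qB[OF I] norm_mult)
      then show "norm (f (emb I (of_real r * cis t))) powr p' \<le> C powr p'"
        using C p' by (intro powr_mono2) auto
    qed auto
    then have "slice_mean p' f I r \<le> C powr p'" by (simp add: slice_mean_def field_simps)
    then have "slice_mean p' f I r powr (1 / p') \<le> (C powr p') powr (1 / p')"
      using p' slice_mean_nonneg by (intro powr_mono2) auto
    also have "\<dots> = C" using p' C0 by (simp add: powr_powr)
    finally show ?thesis .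
  qed
  then show ?thesis unfolding p'(1) hardy_norm_eq_SUP[OF f p'(2)] by (auto intro!: SUP_least)
qed

lemma hardy_norm_nonneg:
  assumes f: "qseries f a" and p: "1 \<le> p"
  shows "0 \<le> hardy_norm p f"
proof (cases "p = \<infinity>")
  case True
  have "0 \<le> ereal (norm (f 0))" by simp
  also have "\<dots> \<le> hardy_norm p f"
    using True by (auto simp: hardy_norm_def qB_iff intro!: SUP_upper)
  finally show ?thesis .
next
  case False
  then obtain p' where p': "p = ereal p'" "1 \<le> p'" using p by (cases p) (auto simp: one_ereal_def)
  obtain I where I: "I \<in> qS" using qS_nonempty by blast
  have "0 \<le> ereal (slice_mean p' f I 0 powr (1 / p'))" by simp
  also have "\<dots> \<le> hardy_norm p f"
    unfolding p'(1) hardy_norm_eq_SUP[OF f p'(2)]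
    by (rule SUP_upper2[OF I], rule SUP_upper) auto
  finally show ?thesis .
qed

lemma coeff_le_hardy_norm:
  assumes f: "qseries f a" and p: "1 \<le> p" and M: "hardy_norm p f \<le> ereal M"
  shows "norm (a n) \<le> M"
proof -
  obtain I where I: "I \<in> qS" using qS_nonempty by blast
  have mean: "slice_mean 1 f I r \<le> M" if r: "0 \<le> r" "r < 1" for r
  proof (cases "p = \<infinity>")
    case True
    have "norm (f q) \<le> M" if "q \<in> qB" for q
    proof -
      have "ereal (norm (f q)) \<le> hardy_norm p f"
        using True that by (auto simp: hardy_norm_def intro!: SUP_upper)
      also note M
      finally show ?thesis by simp
    qed
    then have "hardy_norm (ereal 1) f \<le> ereal M"
      by (intro hardy_norm_le_sup[OF f]) auto
    then have "(SUP I\<in>qS. SUP r\<in>{0..<1}. ereal (slice_mean 1 f I r powr (1 / 1))) \<le> ereal M"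
      using hardy_norm_eq_SUP[OF f order_refl] by simp
    then have "slice_mean 1 f I r powr (1 / 1) \<le> M"
      using I r unfolding SUP_le_iff by auto
    then show ?thesis using slice_mean_nonneg by simp
  next
    case False
    then obtain p' where p': "p = ereal p'" "1 \<le> p'" using p by (cases p) (auto simp: one_ereal_def)
    have "slice_mean p' f I r powr (1 / p') \<le> M"
      using M I r unfolding p'(1) hardy_norm_eq_SUP[OF f p'(2)] SUP_le_iff by auto
    with slice_mean_1_le[OF f I r p'(2)] show ?thesis by simp
  qed
  have "((\<lambda>r. r ^ n * norm (a n)) \<longlongrightarrow> 1 ^ n * norm (a n)) (at_left 1)"
    by (intro tendsto_intros)
  moreover have "\<forall>\<^sub>F r in at_left 1. (r::real) \<in> {0<..<1}"
    by (rule eventually_at_leftI[of 0]) auto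
  then have "\<forall>\<^sub>F r in at_left 1. r ^ n * norm (a n) \<le> M"
    by eventually_elim (use order_trans[OF coeff_le_slice_mean[OF f I] mean] in auto)
  ultimately have "1 ^ n * norm (a n) \<le> M"
    by (rule tendsto_upperbound) simp
  then show ?thesis by simp
qed

section \<open>Star products\<close>

lemma double_series_sums:
  fixes u :: "nat \<Rightarrow> nat \<Rightarrow> 'a::banach"
  assumes bound: "\<And>k m. norm (u k m) \<le> A k * B m"
    and A: "summable A" "\<And>k. 0 \<le> A k" and B: "summable B" "\<And>m. 0 \<le> B m"
  obtains S where "(\<lambda>k. \<Sum>m. u k m) sums S" "(\<lambda>m. \<Sum>k. u k m) sums S"
    "(\<lambda>n. \<Sum>k\<le>n. u k (n - k)) sums S"
proof -
  have "(\<lambda>(k, m). A k * B m) summable_on UNIV \<times> UNIV"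
  proof (rule summable_on_SigmaI)
    show "((\<lambda>m. case (k, m) of (k, m) \<Rightarrow> A k * B m) has_sum A k * suminf B) UNIV" for k
      using B by (auto intro!: has_sum_cmult_right norm_summable_imp_has_sum)
    show "(\<lambda>k. A k * suminf B) summable_on UNIV"
      using A B by (intro norm_summable_imp_summable_on)
        (auto simp: abs_mult suminf_nonneg intro!: summable_mult2)
  qed (use A B in auto)
  then have "(\<lambda>(k, m). u k m) abs_summable_on UNIV \<times> UNIV"
    by (rule summable_on_comparison_test) (use bound in auto)
  then have "(\<lambda>(k, m). u k m) summable_on UNIV \<times> UNIV"
    by (rule abs_summable_summable)
  then obtain S where S: "((\<lambda>(k, m). u k m) has_sum S) (UNIV \<times> UNIV)"
    by (auto simp: summable_on_def)
  have "((\<lambda>m. u k m) has_sum (\<Sum>m. u k m)) UNIV" for k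
  proof -
    have "summable (\<lambda>m. norm (u k m))"
      by (rule summable_comparison_test'[OF summable_mult[OF B(1), of "A k"], of 0]) (use bound in auto)
    from norm_summable_imp_has_sum[OF this summable_sums[OF summable_norm_cancel[OF this]]]
    show ?thesis .
  qed
  then have "((\<lambda>k. \<Sum>m. u k m) has_sum S) UNIV"
    by (intro has_sum_SigmaD[OF S]) simp
  then have rows: "(\<lambda>k. \<Sum>m. u k m) sums S" by (rule has_sum_imp_sums)
  have S': "((\<lambda>(m, k). u k m) has_sum S) (UNIV \<times> UNIV)"
    using S has_sum_swap[of "\<lambda>(m, k). u k m" UNIV UNIV S] by simp
  have "((\<lambda>k. u k m) has_sum (\<Sum>k. u k m)) UNIV" for m
  proof -
    have "summable (\<lambda>k. norm (u k m))"
      by (rule summable_comparison_test'[OF summable_mult2[OF A(1), of "B m"], of 0]) (use bound in auto)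
    from norm_summable_imp_has_sum[OF this summable_sums[OF summable_norm_cancel[OF this]]]
    show ?thesis .
  qed
  then have "((\<lambda>m. \<Sum>k. u k m) has_sum S) UNIV"
    by (intro has_sum_SigmaD[OF S']) simp
  then have cols: "(\<lambda>m. \<Sum>k. u k m) sums S" by (rule has_sum_imp_sums)
  have "bij_betw (\<lambda>(n, k). (k, n - k)) (SIGMA n:UNIV. {..n}) (UNIV \<times> (UNIV :: nat set))"
    by (rule bij_betwI[where g = "\<lambda>(k, m). (k + m, k)"]) auto
  from has_sum_reindex_bij_betw[OF this, of "\<lambda>(k, m). u k m" S] S
  have "((\<lambda>(n, k). u k (n - k)) has_sum S) (SIGMA n:UNIV. {..n})"
    by (simp add: case_prod_unfold)
  then have "((\<lambda>n. \<Sum>k\<le>n. u k (n - k)) has_sum S) UNIV"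
    by (rule has_sum_SigmaD) (auto intro: has_sum_finite)
  then have "(\<lambda>n. \<Sum>k\<le>n. u k (n - k)) sums S" by (rule has_sum_imp_sums)
  with rows cols show thesis by (rule that)
qed

lemma star_prod_sums:
  assumes f: "qseries f a" and g: "qseries g b" and q: "q \<in> qB"
  shows "(\<lambda>n. q ^ n * (\<Sum>k\<le>n. a k * b (n - k))) sums star_prod f g q"
    and "(\<lambda>m. q ^ m * f q * b m) sums star_prod f g q"
proof -
  define u where "u k m = q ^ m * (q ^ k * a k) * b m" for k m
  have r: "0 \<le> norm q" "norm q < 1" using q by (auto simp: qB_iff)
  obtain S where S: "(\<lambda>m. \<Sum>k. u k m) sums S" "(\<lambda>n. \<Sum>k\<le>n. u k (n - k)) sums S"
  proof (rule double_series_sums)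
    show "norm (u k m) \<le> (norm q ^ k * norm (a k)) * (norm q ^ m * norm (b m))" for k m
      by (simp add: u_def norm_mult norm_power)
  qed (use qseries_abs_summable[OF f r] qseries_abs_summable[OF g r] in auto)
  have "(\<Sum>k\<le>n. u k (n - k)) = q ^ n * (\<Sum>k\<le>n. a k * b (n - k))" for n
    unfolding sum_distrib_left u_def
    by (intro sum.cong) (auto simp flip: mult.assoc power_add)
  with S(2) have 1: "(\<lambda>n. q ^ n * (\<Sum>k\<le>n. a k * b (n - k))) sums S" by simp
  have "(\<lambda>k. u k m) sums (q ^ m * f q * b m)" for m
    unfolding u_def using f q by (intro sums_mult2 sums_mult) (simp add: qseries_def)
  then have "(\<Sum>k. u k m) = q ^ m * f q * b m" for m
    by (rule sums_unique[symmetric])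
  with S(1) have 2: "(\<lambda>m. q ^ m * f q * b m) sums S" by simp
  have "star_prod f g q = S"
    unfolding star_prod_def coeffs_eqI[OF f] coeffs_eqI[OF g] using 1 by (rule sums_unique[symmetric])
  with 1 2 show "(\<lambda>n. q ^ n * (\<Sum>k\<le>n. a k * b (n - k))) sums star_prod f g q"
    "(\<lambda>m. q ^ m * f q * b m) sums star_prod f g q" by auto
qed

lemma qseries_star_prod:
  "qseries f a \<Longrightarrow> qseries g b \<Longrightarrow> qseries (star_prod f g) (\<lambda>n. \<Sum>k\<le>n. a k * b (n - k))"
  unfolding qseries_def[of "star_prod f g"] by (auto intro: star_prod_sums(1))

text \<open>Where \<open>f q\<close> does not vanish, the star product at \<open>q\<close> is \<open>f q\<close> times the value of \<open>g\<close> at the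
  conjugate \<open>(f q)\<^sup>-\<^sup>1 q (f q)\<close>, which has the same norm as \<open>q\<close>.\<close>

lemma norm_star_prod_le:
  assumes f: "qseries f a" and g: "qseries g b" and q: "q \<in> qB"
    and C: "\<And>q. q \<in> qB \<Longrightarrow> norm (g q) \<le> C"
  shows "norm (star_prod f g q) \<le> norm (f q) * C"
proof (cases "f q = 0")
  case True
  have "star_prod f g q = 0"
    using sums_unique2[OF star_prod_sums(2)[OF f g q], of 0] by (simp add: True)
  with True show ?thesis by simp
next
  case False
  define q' where "q' = inverse (f q) * q * f q"
  have "norm q' = norm q" using False by (simp add: q'_def norm_mult norm_inverse)
  with q have q': "q' \<in> qB" by (simp add: qB_iff)
  have pow: "f q * q' ^ m = q ^ m * f q" for m
  proof (induction m)
    case (Suc m)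
    have "f q * q' ^ Suc m = q ^ m * f q * q'"
      by (simp only: power_Suc2 mult.assoc[symmetric] Suc)
    also have "\<dots> = q ^ m * (f q * inverse (f q)) * q * f q"
      by (simp only: q'_def mult.assoc)
    also have "\<dots> = q ^ Suc m * f q"
      by (simp only: right_inverse[OF False] mult_1_right power_Suc2)
    finally show ?case .
  qed simp
  have "(\<lambda>m. f q * (q' ^ m * b m)) sums (f q * g q')"
    using g q' by (intro sums_mult) (simp add: qseries_def)
  then have "(\<lambda>m. q ^ m * f q * b m) sums (f q * g q')"
    by (simp add: pow flip: mult.assoc)
  with star_prod_sums(2)[OF f g q] have "star_prod f g q = f q * g q'"
    by (rule sums_unique2)
  then show ?thesis using C[OF q'] by (simp add: norm_mult mult_left_mono)
qed

lemma qseries_const: "qseries (\<lambda>_. x) (\<lambda>n. if n = 0 then x else 0)"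
  unfolding qseries_def
proof
  fix q :: quat
  have "(\<lambda>n. q ^ n * (if n = 0 then x else 0)) = (\<lambda>n. if n = 0 then x else 0)" by auto
  then show "(\<lambda>n. q ^ n * (if n = 0 then x else 0)) sums x"
    using sums_single[of 0 "\<lambda>_. x"] by simp
qed

lemma qseries_star_pow:
  assumes "qseries \<phi> a"
  shows "qseries (star_pow \<phi> n) (coeffs (star_pow \<phi> n))"
proof (induction n)
  case 0
  then show ?case using qseries_const[of 1] coeffs_eqI[OF qseries_const[of 1]] by simp
next
  case (Suc n)
  show ?case
    using qseries_star_prod[OF assms Suc] by (simp add: coeffs_eqI[OF qseries_star_prod[OF assms Suc]])
qed

lemma norm_star_pow_le:
  assumes "qseries \<phi> a" and "\<And>q. q \<in> qB \<Longrightarrow> norm (\<phi> q) \<le> c" and "q \<in> qB"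
  shows "norm (star_pow \<phi> n q) \<le> c ^ n"
  using \<open>q \<in> qB\<close>
proof (induction n arbitrary: q)
  case (Suc n)
  have "norm (star_prod \<phi> (star_pow \<phi> n) q) \<le> norm (\<phi> q) * c ^ n"
    by (rule norm_star_prod_le[OF assms(1) qseries_star_pow[OF assms(1)]]) (use Suc in auto)
  also have "\<dots> \<le> c * c ^ n"
    using assms(2) Suc.prems order_trans[OF norm_ge_zero assms(2)[OF Suc.prems]]
    by (intro mult_right_mono) auto
  finally show ?case by simp
qed simp

section \<open>Compactness\<close>

lemma geometric_weight_summable:
  assumes "0 \<le> c" "c < (1::real)" and "\<And>n. norm (x n) \<le> M"
  shows "summable (\<lambda>n. c ^ n * norm (x n))"
proof (rule summable_comparison_test'[of "\<lambda>n. c ^ n * M" 0])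
  show "summable (\<lambda>n. c ^ n * M)" using assms by (intro summable_mult2 summable_geometric) auto
  show "norm (c ^ n * norm (x n)) \<le> c ^ n * M" for n
    using assms by (auto simp: abs_mult intro!: mult_left_mono)
qed

lemma coeffs_add:
  assumes "slice_regular f qB" "slice_regular g qB"
  shows "coeffs (\<lambda>q. f q + g q) = (\<lambda>n. coeffs f n + coeffs g n)"
  using qseries_coeffs[OF assms(1)] qseries_coeffs[OF assms(2)]
  by (intro coeffs_eqI) (auto simp: qseries_def distrib_left intro!: sums_add)

lemma coeffs_scaleR:
  assumes "slice_regular f qB"
  shows "coeffs (\<lambda>q. r *\<^sub>R f q) = (\<lambda>n. r *\<^sub>R coeffs f n)"
proof (rule coeffs_eqI)
  show "qseries (\<lambda>q. r *\<^sub>R f q) (\<lambda>n. r *\<^sub>R coeffs f n)"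
    unfolding qseries_def
  proof
    fix q assume "q \<in> qB"
    with qseries_coeffs[OF assms] have "(\<lambda>n. q ^ n * coeffs f n) sums f q"
      by (simp add: qseries_def)
    then have "(\<lambda>n. r *\<^sub>R (q ^ n * coeffs f n)) sums (r *\<^sub>R f q)"
      by (rule bounded_linear.sums[OF bounded_linear_scaleR_right])
    then show "(\<lambda>n. q ^ n * r *\<^sub>R coeffs f n) sums (r *\<^sub>R f q)" by simp
  qed
qed

lemma hardy_coeff_bound:
  assumes "f \<in> hardy p" "1 \<le> p"
  obtains M where "\<And>n. norm (coeffs f n) \<le> M"
proof -
  have f: "qseries f (coeffs f)" using assms by (simp add: hardy_def qseries_coeffs)
  have "hardy_norm p f < \<infinity>" using assms by (simp add: hardy_def)
  with hardy_norm_nonneg[OF f assms(2)] obtain M where "hardy_norm p f = ereal M"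
    by (cases "hardy_norm p f") auto
  then have "norm (coeffs f n) \<le> M" for n
    by (intro coeff_le_hardy_norm[OF f assms(2)]) simp
  then show thesis by (rule that)
qed

text \<open>Both composition operators have the form \<open>T f = (\<Sum>n. E n (coeffs f n))\<close> with \<open>E n\<close> real linear in
  the coefficient and of norm at most \<open>c ^ n\<close>. Hardy-bounded functions have uniformly bounded coefficients,
  so a diagonal subsequence converges coefficientwise, and the geometric weights turn this into uniform
  convergence of the images.\<close>

locale geometric_operator =
  fixes c :: real and E :: "nat \<Rightarrow> quat \<Rightarrow> quat \<Rightarrow> quat"
  assumes c: "0 \<le> c" "c < 1"
    and regular: "slice_regular (E n x) qB"
    and bound: "q \<in> qB \<Longrightarrow> norm (E n x q) \<le> c ^ n * norm x"
    and add: "q \<in> qB \<Longrightarrow> E n (x + y) q = E n x q + E n y q"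
    and scale: "q \<in> qB \<Longrightarrow> E n (r *\<^sub>R x) q = r *\<^sub>R E n x q"
begin

definition Sum :: "(nat \<Rightarrow> quat) \<Rightarrow> quat \<Rightarrow> quat" where
  "Sum x q = (\<Sum>n. E n (x n) q)"

lemma diff: "q \<in> qB \<Longrightarrow> E n (x - y) q = E n x q - E n y q"
  using add[of q n x "- y"] scale[of q n "-1" y] by simp

lemma norm_summable:
  assumes "\<And>n. norm (x n) \<le> M" "q \<in> qB"
  shows "summable (\<lambda>n. norm (E n (x n) q))"
  by (rule summable_comparison_test'[OF geometric_weight_summable[OF c assms(1)], of 0])
    (use bound[OF assms(2)] in auto)

lemma norm_Sum_le:
  assumes "\<And>n. norm (x n) \<le> M" "q \<in> qB"
  shows "norm (Sum x q) \<le> (\<Sum>n. c ^ n * norm (x n))"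
proof -
  have "norm (Sum x q) \<le> (\<Sum>n. norm (E n (x n) q))"
    unfolding Sum_def by (rule summable_norm[OF norm_summable[OF assms]])
  also have "\<dots> \<le> (\<Sum>n. c ^ n * norm (x n))"
    by (rule suminf_le[OF bound[OF assms(2)] norm_summable[OF assms] geometric_weight_summable[OF c assms(1)]])
  finally show ?thesis .
qed

lemma qseries_Sum:
  assumes x: "\<And>n. norm (x n) \<le> M"
  obtains d where "qseries (Sum x) d"
proof -
  define e where "e n = coeffs (E n (x n))" for n
  have e: "qseries (E n (x n)) (e n)" for n
    unfolding e_def by (rule qseries_coeffs[OF regular])
  have M: "0 \<le> M" using norm_ge_zero x by (rule order_trans)
  have e_le: "norm (e n m) \<le> c ^ n * M" for n m
  proof (rule coeff_le_hardy_norm[OF e, of \<infinity>])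
    show "hardy_norm \<infinity> (E n (x n)) \<le> ereal (c ^ n * M)"
    proof (rule hardy_norm_le_sup[OF e])
      fix q assume "q \<in> qB"
      then have "norm (E n (x n) q) \<le> c ^ n * norm (x n)" by (rule bound)
      also have "\<dots> \<le> c ^ n * M" using c x by (intro mult_left_mono) auto
      finally show "norm (E n (x n) q) \<le> c ^ n * M" .
    qed simp
  qed simp
  have cM: "summable (\<lambda>n. c ^ n * M)" using c by (intro summable_mult2 summable_geometric) auto
  have esum: "(\<lambda>n. e n m) sums (\<Sum>n. e n m)" for m
    by (rule summable_sums, rule summable_comparison_test'[OF cM, of 0]) (use e_le in auto)
  have "qseries (Sum x) (\<lambda>m. \<Sum>n. e n m)"
    unfolding qseries_def
  proof
    fix q assume q: "q \<in> qB"
    define u where "u n m = q ^ m * e n m" for n m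
    obtain S where S: "(\<lambda>n. \<Sum>m. u n m) sums S" "(\<lambda>m. \<Sum>n. u n m) sums S"
    proof (rule double_series_sums)
      show "norm (u n m) \<le> c ^ n * M * norm q ^ m" for n m
        using mult_left_mono[OF e_le[of n m], of "norm q ^ m"]
        by (simp add: u_def norm_mult norm_power mult.commute)
      show "summable (\<lambda>m. norm q ^ m)" using q by (simp add: qB_iff summable_geometric)
    qed (use cM c M in auto)
    have "(\<Sum>m. u n m) = E n (x n) q" for n
      unfolding u_def using e q by (auto simp: qseries_def sums_iff)
    with S(1) have "Sum x q = S" by (simp add: Sum_def sums_iff)
    moreover have "(\<Sum>n. u n m) = q ^ m * (\<Sum>n. e n m)" for m
      unfolding u_def using sums_mult[OF esum] by (simp add: sums_iff)
    ultimately show "(\<lambda>m. q ^ m * (\<Sum>n. e n m)) sums Sum x q" using S(2) by simp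
  qed
  then show thesis by (rule that)
qed

lemma compact_hardy_op:
  assumes p: "1 \<le> p" and T: "\<And>f q. q \<in> qB \<Longrightarrow> T f q = Sum (coeffs f) q"
  shows "compact_hardy_op p T"
  unfolding compact_hardy_op_def
proof (intro conjI ballI allI impI)
  have hardyI: "f \<in> hardy p"
    if eq: "\<And>q. q \<in> qB \<Longrightarrow> f q = Sum x q" and x: "\<And>n. norm (x n) \<le> M" for f x M
  proof -
    obtain d where "qseries (Sum x) d" by (rule qseries_Sum[OF x])
    then have f: "qseries f d" using eq by (simp add: qseries_def)
    have "hardy_norm p f \<le> ereal (\<Sum>n. c ^ n * norm (x n))"
      using norm_Sum_le[OF x] eq by (intro hardy_norm_le_sup[OF f p]) simp
    then have "hardy_norm p f < \<infinity>" by (auto simp: order_le_less_trans)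
    with qseries_imp_slice_regular[OF f] show ?thesis by (simp add: hardy_def)
  qed
  {
    fix f assume f: "f \<in> hardy p"
    obtain M where M: "\<And>n. norm (coeffs f n) \<le> M" using hardy_coeff_bound[OF f p] by blast
    show "T f \<in> hardy p" by (rule hardyI[OF T M])
  next
    fix f g q assume f: "f \<in> hardy p" and g: "g \<in> hardy p" and q: "q \<in> qB"
    obtain M where M: "\<And>n. norm (coeffs f n) \<le> M" using hardy_coeff_bound[OF f p] by blast
    obtain N where N: "\<And>n. norm (coeffs g n) \<le> N" using hardy_coeff_bound[OF g p] by blast
    have "coeffs (\<lambda>x. f x + g x) = (\<lambda>n. coeffs f n + coeffs g n)"
      using f g by (intro coeffs_add) (auto simp: hardy_def)
    then show "T (\<lambda>x. f x + g x) q = T f q + T g q"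
      using q norm_summable[OF M q] norm_summable[OF N q]
      by (simp add: T Sum_def add suminf_add summable_norm_cancel)
  next
    fix f r q assume f: "f \<in> hardy p" and q: "q \<in> qB"
    obtain M where M: "\<And>n. norm (coeffs f n) \<le> M" using hardy_coeff_bound[OF f p] by blast
    have "coeffs (\<lambda>x. r *\<^sub>R f x) = (\<lambda>n. r *\<^sub>R coeffs f n)"
      using f by (intro coeffs_scaleR) (auto simp: hardy_def)
    then show "T (\<lambda>x. r *\<^sub>R f x) q = r *\<^sub>R T f q"
      using q norm_summable[OF M q]
      by (simp add: T Sum_def scale suminf_scaleR_right summable_norm_cancel)
  next
    fix F :: "nat \<Rightarrow> quat \<Rightarrow> quat"
    assume F: "\<forall>k. F k \<in> hardy p" and "\<exists>M. \<forall>k. hardy_norm p (F k) \<le> ereal M"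
    then obtain M where "\<And>k. hardy_norm p (F k) \<le> ereal M" by blast
    then have M: "norm (coeffs (F k) n) \<le> M" for k n
      using F p by (intro coeff_le_hardy_norm[of "F k"] qseries_coeffs) (auto simp: hardy_def)
    obtain r where r: "strict_mono r" and ex: "\<And>n. \<exists>l. (\<lambda>k. coeffs (F (r k)) n) \<longlonglongrightarrow> l"
      using function_convergent_subsequence[of UNIV "\<lambda>k. coeffs (F k)" M] M by auto
    have "\<forall>n. \<exists>l. (\<lambda>k. coeffs (F (r k)) n) \<longlonglongrightarrow> l" using ex by blast
    from choice[OF this] obtain x where x: "\<And>n. (\<lambda>k. coeffs (F (r k)) n) \<longlonglongrightarrow> x n" by blast
    have xM: "norm (x n) \<le> M" for n
      by (rule tendsto_upperbound[OF tendsto_norm[OF x]]) (use M in auto)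
    have g: "Sum x \<in> hardy p" by (rule hardyI[OF refl xM])
    define y where "y k n = coeffs (F (r k)) n - x n" for k n
    have yM: "norm (y k n) \<le> M + M" for k n
      unfolding y_def by (rule order_trans[OF norm_triangle_ineq4 add_mono[OF M xM]])
    define B where "B k = (\<Sum>n. c ^ n * norm (y k n))" for k
    have "(\<lambda>k. c ^ n * norm (y k n)) \<longlonglongrightarrow> c ^ n * norm (x n - x n)" for n
      unfolding y_def by (intro tendsto_intros x)
    then have "(\<lambda>k. c ^ n * norm (y k n)) \<longlonglongrightarrow> 0" for n by simp
    moreover have "norm (c ^ n * norm (y k n)) \<le> c ^ n * (M + M)" for n k
      using c yM by (auto simp: abs_mult intro!: mult_left_mono)
    then have "eventually (\<lambda>(n, k). norm (c ^ n * norm (y k n)) \<le> c ^ n * (M + M)) (at_top \<times>\<^sub>F sequentially)"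
      by (intro always_eventually) auto
    moreover have "summable (\<lambda>n. c ^ n * (M + M))" using c by (intro summable_mult2 summable_geometric) auto
    ultimately have "B \<longlonglongrightarrow> (\<Sum>n. 0)"
      unfolding B_def
      using tannerys_theorem[of "\<lambda>n k. c ^ n * norm (y k n)" "\<lambda>_. 0" sequentially "\<lambda>n. c ^ n * (M + M)"]
      by simp
    then have B0: "(\<lambda>k. ereal (B k)) \<longlonglongrightarrow> 0" by (simp add: zero_ereal_def)
    have h: "T (F (r k)) q - Sum x q = Sum (y k) q" if q: "q \<in> qB" for k q
      using norm_summable[OF M q] norm_summable[OF xM q]
      by (simp add: T q Sum_def y_def diff suminf_diff summable_norm_cancel)
    have hq: "\<exists>d. qseries (\<lambda>q. T (F (r k)) q - Sum x q) d" for k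
    proof -
      obtain d where "qseries (Sum (y k)) d" by (rule qseries_Sum[OF yM])
      then show ?thesis using h by (auto simp: qseries_def)
    qed
    have "(\<lambda>k. hardy_norm p (\<lambda>q. T (F (r k)) q - Sum x q)) \<longlonglongrightarrow> 0"
    proof (rule tendsto_sandwich[OF _ _ tendsto_const B0])
      show "\<forall>\<^sub>F k in sequentially. 0 \<le> hardy_norm p (\<lambda>q. T (F (r k)) q - Sum x q)"
        using hq hardy_norm_nonneg[OF _ p] by (intro always_eventually) blast
      have "hardy_norm p (\<lambda>q. T (F (r k)) q - Sum x q) \<le> ereal (B k)" for k
      proof -
        obtain d where "qseries (\<lambda>q. T (F (r k)) q - Sum x q) d" using hq by blast
        then show ?thesis
          by (rule hardy_norm_le_sup[OF _ p]) (simp add: h B_def norm_Sum_le[OF yM])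
      qed
      then show "\<forall>\<^sub>F k in sequentially. hardy_norm p (\<lambda>q. T (F (r k)) q - Sum x q) \<le> ereal (B k)"
        by (intro always_eventually) blast
    qed
    with r g show "\<exists>r g. strict_mono r \<and> g \<in> hardy p \<and>
        (\<lambda>k. hardy_norm p (\<lambda>q. T (F (r k)) q - g q)) \<longlonglongrightarrow> 0" by blast
  }
qed

end

theorem theorem8p1:
  fixes \<phi> :: "quat \<Rightarrow> quat" and p :: ereal
  assumes "slice_regular \<phi> qB"
    and "\<phi> ` qB \<subseteq> qB"
    and "(SUP q\<in>qB. norm (\<phi> q)) < 1"
    and "1 \<le> p"
  shows "compact_hardy_op p (C_op \<phi>) \<and> compact_hardy_op p (D_op \<phi>)"
proof -
  define c where "c = (SUP q\<in>qB. norm (\<phi> q))"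
  have "bdd_above ((\<lambda>q. norm (\<phi> q)) ` qB)"
    using assms(2) by (intro bdd_aboveI[of _ 1]) (auto simp: qB_iff image_subset_iff less_imp_le)
  then have \<phi>c: "norm (\<phi> q) \<le> c" if "q \<in> qB" for q
    unfolding c_def using that by (intro cSUP_upper)
  have c: "0 \<le> c" "c < 1"
    using order_trans[OF norm_ge_zero \<phi>c[of 0]] assms(3) by (auto simp: qB_iff c_def)
  note \<phi> = qseries_coeffs[OF assms(1)]
  note pow = qseries_star_pow[OF \<phi>] and pow_le = norm_star_pow_le[OF \<phi> \<phi>c]
  have D_sums: "(\<lambda>m. q ^ m * x * coeffs (star_pow \<phi> n) m) sums star_prod (\<lambda>_. x) (star_pow \<phi> n) q"
    if "q \<in> qB" for n x q
    by (rule star_prod_sums(2)[OF qseries_const pow that])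
  interpret C: geometric_operator c "\<lambda>n x q. star_pow \<phi> n q * x"
  proof
    show "slice_regular (\<lambda>q. star_pow \<phi> n q * x) qB" for n x
    proof (rule qseries_imp_slice_regular)
      show "qseries (\<lambda>q. star_pow \<phi> n q * x) (\<lambda>m. coeffs (star_pow \<phi> n) m * x)"
        using pow[of n] by (auto simp: qseries_def mult.assoc[symmetric] intro!: sums_mult2)
    qed
  qed (use c pow_le in \<open>auto simp: norm_mult distrib_left mult_right_mono\<close>)
  interpret D: geometric_operator c "\<lambda>n x. star_prod (\<lambda>_. x) (star_pow \<phi> n)"
  proof
    show "slice_regular (star_prod (\<lambda>_. x) (star_pow \<phi> n)) qB" for n x
      by (rule qseries_imp_slice_regular[OF qseries_star_prod[OF qseries_const pow]])
    fix q n x y and r :: real assume q: "q \<in> qB"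
    show "norm (star_prod (\<lambda>_. x) (star_pow \<phi> n) q) \<le> c ^ n * norm x"
      using norm_star_prod_le[OF qseries_const pow q pow_le] by (simp add: mult.commute)
    show "star_prod (\<lambda>_. x + y) (star_pow \<phi> n) q
        = star_prod (\<lambda>_. x) (star_pow \<phi> n) q + star_prod (\<lambda>_. y) (star_pow \<phi> n) q"
      using sums_add[OF D_sums[OF q] D_sums[OF q]]
      by (intro sums_unique2[OF D_sums[OF q]]) (simp add: distrib_left distrib_right)
    show "star_prod (\<lambda>_. r *\<^sub>R x) (star_pow \<phi> n) q = r *\<^sub>R star_prod (\<lambda>_. x) (star_pow \<phi> n) q"
      using bounded_linear.sums[OF bounded_linear_scaleR_right[of r] D_sums[OF q]]
      by (intro sums_unique2[OF D_sums[OF q]]) simp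
  qed (use c in auto)
  show ?thesis
    using C.compact_hardy_op[OF assms(4), of "C_op \<phi>"] D.compact_hardy_op[OF assms(4), of "D_op \<phi>"]
    by (simp add: C_op_def D_op_def C.Sum_def D.Sum_def)
qed

end
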